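(* Let $M=(M^2,\varphi)$ be a two-dimensional monochromatic non-Riemannian Finsler manifold, $V=(V^3,\Phi)$ a $3$-dimensional Banach-Minkowski space, and $f\colon M\to V$ a smooth isometric embedding. Then the second fundamental form of $f$ is degenerate at every point of $M$.
   Context: "Smooth" means $C^\infty$. A norm on a real vector space $V$ is a subadditive, positively homogeneous function $\Phi\colon V\to[0,\infty)$, positive on $V\setminus\{0\}$, not required to be symmetric. A Banach-Minkowski norm is a norm that is smooth on $V\setminus\{0\}$ and such that $\Phi^2$ is quadratically strictly convex (second differential positive definite at every $v\neq0$). A Banach-Minkowski space is a finite-dimensional vector space with a Banach-Minkowski norm. A Finsler manifold $(M,\varphi)$ is a smooth manifold with a continuous $\varphi\colon TM\to[0,\infty)$, smooth on $TM$ minus the zero section, whose restriction to each $T_xM$ is a Banach-Minkowski norm. It is Riemannian if each $\varphi|_{T_xM}$ is a Euclidean norm (i.e. comes from an inner product). It is monochromatic if all tangent spaces $(T_xM,\varphi|_{T_xM})$ are isometric to each other as normed vector spaces (via linear norm-preserving bijections). A smooth embedding $f\colon M\to V$ is isometric if $\Phi(d_xf(v))=\varphi(v)$ for all $x\in M$, $v\in T_xM$. The second fundamental form of a smooth immersion $f\colon M\to V$ at $p$ is the symmetric bilinear form on $T_pM$ with values in $V/\operatorname{Im}d_pf$ defined as the Hessian at $p$ of $\pi\circ f$, where $\pi\colon V\to V/\operatorname{Im}d_pf$ is the quotient map ($p$ is a critical point of $\pi\circ f$, so the Hessian is well defined). Here the quotient is one-dimensional and the form is regarded as a real-valued form up to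 a nonzero constant factor. It is degenerate if it has a nontrivial kernel (the zero form is degenerate). *)

theory Defs
  imports "HOL-Analysis.Analysis" "HOL-Library.Function_Algebras"
begin

section \<open>Smooth maps between Euclidean spaces\<close>

text \<open>\<open>S\<close> is meant to be open. In the class \<open>C\<^sup>n\<close>, all iterated directional derivatives
  up to order \<open>n\<close> exist and are continuous.\<close>

primrec Cn_on :: "nat \<Rightarrow> 'a::real_normed_vector set \<Rightarrow> ('a \<Rightarrow> 'b::real_normed_vector) \<Rightarrow> bool" where
  "Cn_on 0 S f \<longleftrightarrow> continuous_on S f"
| "Cn_on (Suc n) S f \<longleftrightarrow> (\<forall>x\<in>S. f differentiable at x) \<and>
     (\<forall>v. Cn_on n S (\<lambda>x. frechet_derivative f (at x) v))"

definition smooth_on :: "'a::real_normed_vector set \<Rightarrow> ('a \<Rightarrow> 'b::real_normed_vector) \<Rightarrow> bool" where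
  "smooth_on S f \<longleftrightarrow> (\<forall>n. Cn_on n S f)"

definition second_differential ::
    "('a::real_normed_vector \<Rightarrow> 'b::real_normed_vector) \<Rightarrow> 'a \<Rightarrow> 'a \<Rightarrow> 'a \<Rightarrow> 'b" where
  "second_differential f x v w =
     frechet_derivative (\<lambda>y. frechet_derivative f (at y) w) (at x) v"


section \<open>Norms\<close>

text \<open>Norms are only positively homogeneous: \<open>N (- v)\<close> may differ from \<open>N v\<close>. Both notions below are
  relative to a linear subspace \<open>T\<close>, because tangent spaces will be subspaces of one type.\<close>

definition minkowski_norm_on :: "'a::real_vector set \<Rightarrow> ('a \<Rightarrow> real) \<Rightarrow> bool" where
  "minkowski_norm_on T N \<longleftrightarrow>
     (\<forall>v\<in>T. 0 \<le> N v) \<and>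
     (\<forall>v\<in>T. v \<noteq> 0 \<longrightarrow> 0 < N v) \<and>
     (\<forall>v\<in>T. \<forall>w\<in>T. N (v + w) \<le> N v + N w) \<and>
     (\<forall>v\<in>T. \<forall>r\<ge>0. N (r *\<^sub>R v) = r * N v)"

text \<open>\<open>B\<close> is an inner product on \<open>T\<close>; every bilinear form on \<open>T\<close> extends to a bilinear form on the
  whole type, so requiring bilinearity on the whole type is no restriction.\<close>

definition euclidean_norm_on :: "'a::real_vector set \<Rightarrow> ('a \<Rightarrow> real) \<Rightarrow> bool" where
  "euclidean_norm_on T N \<longleftrightarrow>
     (\<exists>B. bilinear B \<and>
        (\<forall>v\<in>T. \<forall>w\<in>T. B v w = B w v) \<and>
        (\<forall>v\<in>T. v \<noteq> 0 \<longrightarrow> 0 < B v v) \<and>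
        (\<forall>v\<in>T. N v = sqrt (B v v)))"

definition banach_minkowski_norm :: "('a::euclidean_space \<Rightarrow> real) \<Rightarrow> bool" where
  "banach_minkowski_norm N \<longleftrightarrow>
     minkowski_norm_on UNIV N \<and>
     smooth_on (- {0}) N \<and>
     (\<forall>v w. v \<noteq> 0 \<longrightarrow> w \<noteq> 0 \<longrightarrow> 0 < second_differential (\<lambda>u. (N u)\<^sup>2) v w w)"


section \<open>Smooth manifolds\<close>

text \<open>A chart is a pair of its domain and its coordinate map; the values of the coordinate map
  outside the domain are irrelevant.\<close>

type_synonym ('m, 'e) chart = "'m set \<times> ('m \<Rightarrow> 'e)"

abbreviation cdom :: "('m, 'e) chart \<Rightarrow> 'm set" where
  "cdom c \<equiv> fst c"

abbreviation coord :: "('m, 'e) chart \<Rightarrow> 'm \<Rightarrow> 'e" where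
  "coord c \<equiv> snd c"

abbreviation cinv :: "('m, 'e) chart \<Rightarrow> 'e \<Rightarrow> 'm" where
  "cinv c \<equiv> inv_into (cdom c) (coord c)"

abbreviation transition :: "('m, 'e) chart \<Rightarrow> ('m, 'e) chart \<Rightarrow> 'e \<Rightarrow> 'e" where
  "transition c d \<equiv> coord d \<circ> cinv c"

definition smooth_manifold :: "'m topology \<Rightarrow> ('m, 'e::euclidean_space) chart set \<Rightarrow> bool" where
  "smooth_manifold X A \<longleftrightarrow>
     Hausdorff_space X \<and> second_countable X \<and>
     (\<Union>c\<in>A. cdom c) = topspace X \<and>
     (\<forall>c\<in>A. openin X (cdom c) \<and> open (coord c ` cdom c) \<and>
        homeomorphic_map (subtopology X (cdom c)) (top_of_set (coord c ` cdom c)) (coord c)) \<and>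
     (\<forall>c\<in>A. \<forall>d\<in>A. smooth_on (coord c ` (cdom c \<inter> cdom d)) (transition c d))"


section \<open>Tangent vectors\<close>

instantiation "fun" :: (type, real_vector) real_vector
begin

definition scaleR_fun :: "real \<Rightarrow> ('a \<Rightarrow> 'b) \<Rightarrow> 'a \<Rightarrow> 'b" where
  "scaleR_fun r f = (\<lambda>x. r *\<^sub>R f x)"

instance
  by standard (simp_all add: scaleR_fun_def fun_eq_iff scaleR_add_right scaleR_add_left)

end

lemma scaleR_fun_apply [simp]: "(r *\<^sub>R f) x = r *\<^sub>R f x"
  by (simp add: scaleR_fun_def)

text \<open>A tangent vector at \<open>p\<close> is the family of its coordinate vectors in all charts around \<open>p\<close>
  (and \<open>0\<close> for the irrelevant indices), which transforms by the differentials of the transition maps.\<close>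

definition charts_at :: "('m, 'e) chart set \<Rightarrow> 'm \<Rightarrow> ('m, 'e) chart set" where
  "charts_at A p = {c \<in> A. p \<in> cdom c}"

type_synonym ('m, 'e) tvector = "('m, 'e) chart \<Rightarrow> 'e"

definition tangent_space ::
    "('m, 'e::euclidean_space) chart set \<Rightarrow> 'm \<Rightarrow> ('m, 'e) tvector set" where
  "tangent_space A p =
     {X. (\<forall>c\<in>charts_at A p. \<forall>d\<in>charts_at A p.
            X d = frechet_derivative (transition c d) (at (coord c p)) (X c)) \<and>
         (\<forall>c. c \<notin> charts_at A p \<longrightarrow> X c = 0)}"

text \<open>The tangent vector at \<open>p\<close> whose coordinate vector in the chart \<open>c\<close> is \<open>v\<close>.\<close>

definition tvec ::
    "('m, 'e::euclidean_space) chart set \<Rightarrow> ('m, 'e) chart \<Rightarrow> 'm \<Rightarrow> 'e \<Rightarrow> ('m, 'e) tvector" where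
  "tvec A c p v = (\<lambda>d. if d \<in> charts_at A p
     then frechet_derivative (transition c d) (at (coord c p)) v else 0)"


section \<open>Maps from a manifold to a vector space\<close>

definition some_chart :: "('m, 'e) chart set \<Rightarrow> 'm \<Rightarrow> ('m, 'e) chart" where
  "some_chart A p = (SOME c. c \<in> charts_at A p)"

definition smooth_map ::
    "('m, 'e::euclidean_space) chart set \<Rightarrow> ('m \<Rightarrow> 'v::real_normed_vector) \<Rightarrow> bool" where
  "smooth_map A f \<longleftrightarrow> (\<forall>c\<in>A. smooth_on (coord c ` cdom c) (f \<circ> cinv c))"

text \<open>On \<open>tangent_space A p\<close> the differential does not depend on the chart (chain rule; see
  \<open>differential_eq\<close>).\<close>

definition differential :: "('m, 'e::euclidean_space) chart set \<Rightarrow>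
    ('m \<Rightarrow> 'v::real_normed_vector) \<Rightarrow> 'm \<Rightarrow> ('m, 'e) tvector \<Rightarrow> 'v" where
  "differential A f p X =
     (let c = some_chart A p in frechet_derivative (f \<circ> cinv c) (at (coord c p)) (X c))"

text \<open>The Hessian is only chart-independent when \<open>p\<close> is a critical point of \<open>g\<close>, and is only used
  in that situation.\<close>

definition hessian :: "('m, 'e::euclidean_space) chart set \<Rightarrow>
    ('m \<Rightarrow> 'v::real_normed_vector) \<Rightarrow> 'm \<Rightarrow> ('m, 'e) tvector \<Rightarrow> ('m, 'e) tvector \<Rightarrow> 'v" where
  "hessian A g p X Y =
     (let c = some_chart A p in second_differential (g \<circ> cinv c) (coord c p) (X c) (Y c))"

definition smooth_embedding :: "'m topology \<Rightarrow> ('m, 'e::euclidean_space) chart set \<Rightarrow>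
    ('m \<Rightarrow> 'v::real_normed_vector) \<Rightarrow> bool" where
  "smooth_embedding X A f \<longleftrightarrow>
     smooth_map A f \<and>
     (\<forall>p\<in>topspace X. inj_on (differential A f p) (tangent_space A p)) \<and>
     embedding_map X euclidean f"


section \<open>Finsler manifolds\<close>

text \<open>A function on the tangent bundle is curried: \<open>\<phi> p X\<close> for \<open>X \<in> tangent_space A p\<close>. Here it is
  read in the bundle chart induced by \<open>c\<close>.\<close>

definition in_bundle_chart :: "('m, 'e::euclidean_space) chart set \<Rightarrow> ('m, 'e) chart \<Rightarrow>
    ('m \<Rightarrow> ('m, 'e) tvector \<Rightarrow> real) \<Rightarrow> 'e \<times> 'e \<Rightarrow> real" where
  "in_bundle_chart A c \<phi> = (\<lambda>(x, v). \<phi> (cinv c x) (tvec A c (cinv c x) v))"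

text \<open>The Banach-Minkowski condition on a tangent space is expressed in the linear coordinates
  given by a chart; it is invariant under linear changes of coordinates.\<close>

definition finsler_manifold :: "'m topology \<Rightarrow> ('m, 'e::euclidean_space) chart set \<Rightarrow>
    ('m \<Rightarrow> ('m, 'e) tvector \<Rightarrow> real) \<Rightarrow> bool" where
  "finsler_manifold X A \<phi> \<longleftrightarrow>
     smooth_manifold X A \<and>
     (\<forall>c\<in>A. continuous_on (coord c ` cdom c \<times> UNIV) (in_bundle_chart A c \<phi>) \<and>
             smooth_on (coord c ` cdom c \<times> (- {0})) (in_bundle_chart A c \<phi>)) \<and>
     (\<forall>p\<in>topspace X. \<forall>c\<in>charts_at A p. banach_minkowski_norm (\<lambda>v. \<phi> p (tvec A c p v)))"

definition riemannian :: "'m topology \<Rightarrow> ('m, 'e::euclidean_space) chart set \<Rightarrow>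
    ('m \<Rightarrow> ('m, 'e) tvector \<Rightarrow> real) \<Rightarrow> bool" where
  "riemannian X A \<phi> \<longleftrightarrow> (\<forall>p\<in>topspace X. euclidean_norm_on (tangent_space A p) (\<phi> p))"

text \<open>A linear map between tangent spaces is given as the restriction of a linear map of the whole
  type; every linear map on a subspace is such a restriction.\<close>

definition monochromatic :: "'m topology \<Rightarrow> ('m, 'e::euclidean_space) chart set \<Rightarrow>
    ('m \<Rightarrow> ('m, 'e) tvector \<Rightarrow> real) \<Rightarrow> bool" where
  "monochromatic X A \<phi> \<longleftrightarrow>
     (\<forall>p\<in>topspace X. \<forall>q\<in>topspace X. \<exists>L. linear L \<and>
        bij_betw L (tangent_space A p) (tangent_space A q) \<and>
        (\<forall>Y\<in>tangent_space A p. \<phi> q (L Y) = \<phi> p Y))"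

definition isometric :: "'m topology \<Rightarrow> ('m, 'e::euclidean_space) chart set \<Rightarrow>
    ('m \<Rightarrow> ('m, 'e) tvector \<Rightarrow> real) \<Rightarrow> ('v::real_normed_vector \<Rightarrow> real) \<Rightarrow> ('m \<Rightarrow> 'v) \<Rightarrow> bool" where
  "isometric X A \<phi> \<Phi> f \<longleftrightarrow>
     (\<forall>p\<in>topspace X. \<forall>Y\<in>tangent_space A p. \<Phi> (differential A f p Y) = \<phi> p Y)"


section \<open>Second fundamental form in codimension one\<close>

text \<open>A linear functional that is onto with kernel \<open>W\<close> is the same as the quotient map to \<open>V/W\<close>
  followed by an isomorphism of the line \<open>V/W\<close> with the real line; it is unique up to a nonzero factor.\<close>

definition quotient_functional :: "'v::real_vector set \<Rightarrow> ('v \<Rightarrow> real) \<Rightarrow> bool" where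
  "quotient_functional W \<pi> \<longleftrightarrow> linear \<pi> \<and> surj \<pi> \<and> {v. \<pi> v = 0} = W"

text \<open>\<open>b\<close> is one of the real-valued representatives of the second fundamental form at \<open>p\<close>.\<close>

definition second_fundamental_form :: "('m, 'e::euclidean_space) chart set \<Rightarrow>
    ('m \<Rightarrow> 'v::real_normed_vector) \<Rightarrow> 'm \<Rightarrow> (('m, 'e) tvector \<Rightarrow> ('m, 'e) tvector \<Rightarrow> real) \<Rightarrow> bool" where
  "second_fundamental_form A f p b \<longleftrightarrow>
     (\<exists>\<pi>. quotient_functional (differential A f p ` tangent_space A p) \<pi> \<and>
          b = hessian A (\<pi> \<circ> f) p)"

definition degenerate_on :: "'a::real_vector set \<Rightarrow> ('a \<Rightarrow> 'a \<Rightarrow> real) \<Rightarrow> bool" where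
  "degenerate_on T b \<longleftrightarrow> (\<exists>v\<in>T. v \<noteq> 0 \<and> (\<forall>w\<in>T. b v w = 0))"


section \<open>Well-definedness\<close>

lemma smooth_on_differentiable: "smooth_on S f \<Longrightarrow> x \<in> S \<Longrightarrow> f differentiable at x"
  unfolding smooth_on_def by (metis Cn_on.simps(2))

lemma smooth_manifold_inj:
  assumes "smooth_manifold X A" "c \<in> A"
  shows "inj_on (coord c) (cdom c)"
proof -
  have "homeomorphic_map (subtopology X (cdom c)) (top_of_set (coord c ` cdom c)) (coord c)"
    and "openin X (cdom c)"
    using assms unfolding smooth_manifold_def by auto
  then show ?thesis
    by (metis homeomorphic_imp_injective_map openin_subset topspace_subtopology_subset)
qed

lemma smooth_manifold_open_overlap:
  assumes M: "smooth_manifold X A" and c: "c \<in> A" and d: "d \<in> A"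
  shows "open (coord c ` (cdom c \<inter> cdom d))"
proof -
  have h: "homeomorphic_map (subtopology X (cdom c)) (top_of_set (coord c ` cdom c)) (coord c)"
    and o: "openin X (cdom c)" "openin X (cdom d)" "open (coord c ` cdom c)"
    using assms unfolding smooth_manifold_def by auto
  have "openin (subtopology X (cdom c)) (cdom c \<inter> cdom d)"
    using o by (auto simp: openin_subtopology Int_commute)
  then have "openin (top_of_set (coord c ` cdom c)) (coord c ` (cdom c \<inter> cdom d))"
    using h homeomorphic_imp_open_map open_map_def by blast
  then show ?thesis
    using o(3) openin_open_trans by blast
qed

text \<open>Change of chart for any function of the point, here either a map to \<open>V\<close> or a coordinate map.\<close>

lemma chart_change:
  assumes M: "smooth_manifold X A" and c: "c \<in> charts_at A p" and d: "d \<in> charts_at A p"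
    and g: "(g \<circ> cinv d) differentiable at (coord d p)"
  shows "frechet_derivative (g \<circ> cinv c) (at (coord c p)) v =
         frechet_derivative (g \<circ> cinv d) (at (coord d p))
           (frechet_derivative (transition c d) (at (coord c p)) v)"
proof -
  have cA: "c \<in> A" "p \<in> cdom c" and dA: "d \<in> A" "p \<in> cdom d"
    using c d by (auto simp: charts_at_def)
  let ?S = "coord c ` (cdom c \<inter> cdom d)"
  note inj = smooth_manifold_inj[OF M cA(1)] smooth_manifold_inj[OF M dA(1)]
  have S: "open ?S" "coord c p \<in> ?S"
    using smooth_manifold_open_overlap[OF M cA(1) dA(1)] cA dA by auto
  have "smooth_on ?S (transition c d)"
    using M cA dA unfolding smooth_manifold_def by blast
  then have t: "(transition c d has_derivative
      frechet_derivative (transition c d) (at (coord c p))) (at (coord c p))"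
    using S smooth_on_differentiable frechet_derivative_works by blast
  have tp: "transition c d (coord c p) = coord d p"
    using inj cA by simp
  have "((g \<circ> cinv d) has_derivative frechet_derivative (g \<circ> cinv d) (at (coord d p)))
      (at (transition c d (coord c p)))"
    unfolding tp using g frechet_derivative_works by blast
  from diff_chain_at[OF t this]
  have "((g \<circ> cinv d) \<circ> transition c d has_derivative
      frechet_derivative (g \<circ> cinv d) (at (coord d p)) \<circ>
      frechet_derivative (transition c d) (at (coord c p))) (at (coord c p))" .
  then have "((g \<circ> cinv c) has_derivative
      frechet_derivative (g \<circ> cinv d) (at (coord d p)) \<circ>
      frechet_derivative (transition c d) (at (coord c p))) (at (coord c p))"
    by (rule has_derivative_transform_within_open[OF _ S]) (use inj in auto)
  then show ?thesis
    by (simp add: frechet_derivative_at[symmetric])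
qed

lemma transition_has_derivative:
  assumes M: "smooth_manifold X A" and c: "c \<in> charts_at A p" and d: "d \<in> charts_at A p"
  shows "(transition c d has_derivative
      frechet_derivative (transition c d) (at (coord c p))) (at (coord c p))"
proof -
  have "smooth_on (coord c ` (cdom c \<inter> cdom d)) (transition c d)"
    using M c d unfolding smooth_manifold_def charts_at_def by blast
  then show ?thesis
    using c d smooth_on_differentiable frechet_derivative_works
    unfolding charts_at_def by blast
qed

lemma frechet_derivative_transition_same:
  assumes M: "smooth_manifold X A" and c: "c \<in> charts_at A p"
  shows "frechet_derivative (transition c c) (at (coord c p)) = id"
proof -
  have cA: "c \<in> A" "p \<in> cdom c" using c by (auto simp: charts_at_def)
  have o: "open (coord c ` cdom c)" "coord c p \<in> coord c ` cdom c"
    using M cA unfolding smooth_manifold_def by auto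
  have "(transition c c has_derivative id) (at (coord c p))"
    by (rule has_derivative_transform_within_open[OF has_derivative_id[unfolded id_def[symmetric]] o])
      (auto simp: f_inv_into_f)
  then show ?thesis
    by (simp add: frechet_derivative_at[symmetric])
qed

lemma tangent_spaceD1:
  "Y \<in> tangent_space A p \<Longrightarrow> c \<in> charts_at A p \<Longrightarrow> d \<in> charts_at A p \<Longrightarrow>
     frechet_derivative (transition c d) (at (coord c p)) (Y c) = Y d"
  unfolding tangent_space_def mem_Collect_eq by (metis (no_types))

lemma tangent_spaceD2: "Y \<in> tangent_space A p \<Longrightarrow> c \<notin> charts_at A p \<Longrightarrow> Y c = 0"
  unfolding tangent_space_def by blast

theorem tvec_linear_iso:
  assumes M: "smooth_manifold X A" and c: "c \<in> charts_at A p"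
  shows "linear (tvec A c p)" "bij_betw (tvec A c p) UNIV (tangent_space A p)"
proof -
  have l: "linear (frechet_derivative (transition c d) (at (coord c p)))" if "d \<in> charts_at A p" for d
    using transition_has_derivative[OF M c that] has_derivative_linear by blast
  show "linear (tvec A c p)"
  proof (rule linearI; rule ext)
    show "tvec A c p (v + w) d = (tvec A c p v + tvec A c p w) d" for v w d
      by (simp add: tvec_def linear_add[OF l])
    show "tvec A c p (r *\<^sub>R v) d = (r *\<^sub>R tvec A c p v) d" for r v d
      by (simp add: tvec_def linear_scale[OF l])
  qed
  have at_c: "tvec A c p v c = v" for v
    using c by (simp add: tvec_def frechet_derivative_transition_same[OF M c])
  have "tvec A c p v \<in> tangent_space A p" for v
  proof -
    have "tvec A c p v e = frechet_derivative (transition d e) (at (coord d p)) (tvec A c p v d)"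
      if d: "d \<in> charts_at A p" and e: "e \<in> charts_at A p" for d e
    proof -
      have "(coord e \<circ> cinv d) differentiable at (coord d p)"
        using transition_has_derivative[OF M d e] by (rule differentiableI)
      from chart_change[OF M c d this, of v] show ?thesis
        using d e by (simp only: tvec_def if_True)
    qed
    moreover have "tvec A c p v d = 0" if "d \<notin> charts_at A p" for d
      using that by (simp only: tvec_def if_False)
    ultimately show ?thesis
      unfolding tangent_space_def by blast
  qed
  moreover have "tvec A c p (Y c) = Y" if Y: "Y \<in> tangent_space A p" for Y
  proof
    show "tvec A c p (Y c) d = Y d" for d
    proof (cases "d \<in> charts_at A p")
      case True
      then show ?thesis
        by (simp only: tvec_def if_True tangent_spaceD1[OF Y c])
    next
      case False
      then show ?thesis
        by (simp only: tvec_def if_False tangent_spaceD2[OF Y False])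
    qed
  qed
  ultimately show "bij_betw (tvec A c p) UNIV (tangent_space A p)"
    using at_c by (intro bij_betw_byWitness[where f' = "\<lambda>Y. Y c"]) auto
qed

corollary tangent_space_subspace:
  assumes "smooth_manifold X A" "p \<in> topspace X"
  shows "subspace (tangent_space A p)"
proof -
  obtain c where c: "c \<in> charts_at A p"
    using assms unfolding smooth_manifold_def charts_at_def by blast
  have "tangent_space A p = range (tvec A c p)"
    using tvec_linear_iso(2)[OF assms(1) c] by (simp add: bij_betw_def)
  then show ?thesis
    using tvec_linear_iso(1)[OF assms(1) c] linear_subspace_image subspace_UNIV by metis
qed

theorem differential_eq:
  assumes M: "smooth_manifold X A" and f: "smooth_map A f"
    and c: "c \<in> charts_at A p" and Y: "Y \<in> tangent_space A p"
  shows "differential A f p Y = frechet_derivative (f \<circ> cinv c) (at (coord c p)) (Y c)"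
proof -
  define d where "d = some_chart A p"
  have d: "d \<in> charts_at A p"
    unfolding d_def some_chart_def using c by (rule someI)
  have "(f \<circ> cinv d) differentiable at (coord d p)"
    using f d smooth_on_differentiable unfolding smooth_map_def charts_at_def by blast
  from chart_change[OF M c d this, of "Y c"] show ?thesis
    by (simp only: differential_def d_def[symmetric] Let_def tangent_spaceD1[OF Y c d])
qed

theorem second_fundamental_form_exists:
  fixes A :: "('m, 'e::euclidean_space) chart set" and f :: "'m \<Rightarrow> 'v::euclidean_space"
  assumes M: "smooth_manifold X A" and f: "smooth_embedding X A f" and p: "p \<in> topspace X"
    and dim: "DIM('v) = DIM('e) + 1"
  shows "\<exists>b. second_fundamental_form A f p b"
proof -
  obtain c where c: "c \<in> charts_at A p"
    using M p unfolding smooth_manifold_def charts_at_def by blast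
  let ?D = "frechet_derivative (f \<circ> cinv c) (at (coord c p))"
  let ?W = "differential A f p ` tangent_space A p"
  have sm: "smooth_map A f" and inj: "inj_on (differential A f p) (tangent_space A p)"
    using f p unfolding smooth_embedding_def by auto
  have "(f \<circ> cinv c) differentiable at (coord c p)"
    using sm c smooth_on_differentiable unfolding smooth_map_def charts_at_def by blast
  then have D: "linear ?D"
    by (simp add: linear_frechet_derivative)
  have T: "tangent_space A p = range (tvec A c p)" "inj (tvec A c p)"
    using tvec_linear_iso(2)[OF M c] by (auto simp: bij_betw_def)
  have eq: "differential A f p (tvec A c p v) = ?D v" for v
    using differential_eq[OF M sm c, of "tvec A c p v"] T c
    by (simp add: tvec_def frechet_derivative_transition_same[OF M c])
  have W: "?W = range ?D"
    unfolding T by (auto simp: eq image_image)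
  have inj_D: "inj ?D"
    unfolding eq[symmetric] using inj T comp_inj_on[of "tvec A c p" UNIV] by (simp add: comp_def)
  have dimW: "dim ?W = DIM('e)"
    unfolding W using D inj_D dim_image_eq[of ?D UNIV] by simp
  have sub: "subspace ?W"
    unfolding W using D linear_subspace_image subspace_UNIV by blast
  have "dim ?W < DIM('v)"
    using dimW dim by linarith
  then obtain a where a0: "a \<noteq> 0" and "span ?W \<subseteq> {x. a \<bullet> x = 0}"
    using lowdim_subset_hyperplane[of ?W] by blast
  then have sub_a: "?W \<subseteq> {x. a \<bullet> x = 0}"
    using span_superset[of ?W] by blast
  have "?W = {x. a \<bullet> x = 0}"
    by (rule subspace_dim_equal[OF sub subspace_hyperplane sub_a])
      (use dimW dim dim_hyperplane[OF a0] in simp)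
  moreover have "linear ((\<bullet>) a)"
    by (simp add: bounded_linear.linear bounded_linear_inner_right)
  moreover have "surj ((\<bullet>) a)"
  proof (rule surjI)
    show "a \<bullet> ((r / (a \<bullet> a)) *\<^sub>R a) = r" for r
      using a0 by simp
  qed
  ultimately have "quotient_functional ?W ((\<bullet>) a)"
    unfolding quotient_functional_def by auto
  then show ?thesis
    unfolding second_fundamental_form_def by blast
qed

end

theory Submission
  imports Defs
begin

text \<open>If the second fundamental form is nondegenerate at \<open>p\<close>, then the tangent planes near \<open>p\<close> fill a
  neighbourhood of \<open>T\<^sub>p\<close> in the space of planes, and all of them are isometric to \<open>T\<^sub>p\<close>. Suppose that
  the norm on these planes is not Euclidean. It then has no infinitesimal linear isometries, and the first
  variation of the isometries between the planes shows that along each plane \<open>P\<close> the unit sphere is touched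
  by a cylinder with some direction \<open>e\<^sub>P\<close>. Differentiating the condition \<open>d\<Phi>\<^sub>v(e\<^sub>P) = 0\<close> for
  \<open>v \<in> P\<close> with respect to \<open>P\<close> yields a nonzero linear vector field tangent to the unit circle of \<open>P\<close>, that is
  an infinitesimal isometry, a contradiction. So \<open>T\<^sub>p\<close> is Euclidean, and by monochromaticity \<open>M\<close> is
  Riemannian.\<close>

section \<open>Squares of Minkowski norms\<close>

text \<open>Monochromaticity supplies an isometry for each plane separately, with no regularity in
  the plane, so neither the isometries nor the directions of the cylinders can be differentiated.
  Compactness takes the place of differentiability. If the difference quotients are bounded, a
  subsequential limit satisfies the linearized equation for all \<open>s\<close> at once, which is
  all that is needed of a derivative. If they are unbounded, they are rescaled to unit length, and
  the limit satisfies the same equation without its inhomogeneous part. The squared norm replaces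
  the norm because Euler's relation and positive definiteness then hold in every direction, the
  radial one included. Convexity acts through the second derivative in the direction of the
  cylinder: it is positive, and this keeps the linear field obtained at the end from
  vanishing.\<close>

text \<open>No continuity of \<open>d\<close> is assumed. In the second case, dividing by
  \<open>norm (d n)\<close> instead of \<open>t n\<close> sends every term proportional to
  \<open>t\<close> to 0, while the direction of \<open>d\<close> survives as a unit vector.\<close>

lemma blowup_dichotomy:
  fixes d :: "nat \<Rightarrow> 'a::euclidean_space" and t :: "nat \<Rightarrow> real"
  assumes t: "\<And>n. 0 < t n" and t0: "t \<longlonglongrightarrow> 0"
  obtains (bounded) r B where "strict_mono r" "(\<lambda>n. d (r n) /\<^sub>R t (r n)) \<longlonglongrightarrow> B"
  | (unbounded) r u where "strict_mono r" "norm u = 1" "\<And>n. d (r n) \<noteq> 0"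
      "(\<lambda>n. d (r n) /\<^sub>R norm (d (r n))) \<longlonglongrightarrow> u" "(\<lambda>n. t (r n) / norm (d (r n))) \<longlonglongrightarrow> 0"
proof (cases "bounded (range (\<lambda>n. d n /\<^sub>R t n))")
  case True
  then obtain l r where "strict_mono r" "((\<lambda>n. d n /\<^sub>R t n) \<circ> r) \<longlonglongrightarrow> l"
    using bounded_imp_convergent_subsequence by blast
  then show ?thesis
    using bounded by (simp add: o_def)
next
  case False
  have "\<exists>m>N. real (Suc k) < norm (d m /\<^sub>R t m)" for N k
  proof (rule ccontr)
    assume "\<not> ?thesis"
    then have *: "norm (d m /\<^sub>R t m) \<le> real (Suc k)" if "m > N" for m
      using that by force
    have "range (\<lambda>n. d n /\<^sub>R t n) \<subseteq> (\<lambda>n. d n /\<^sub>R t n) ` {..N} \<union> cball 0 (real (Suc k))"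
    proof (rule image_subsetI)
      fix m
      show "d m /\<^sub>R t m \<in> (\<lambda>n. d n /\<^sub>R t n) ` {..N} \<union> cball 0 (real (Suc k))"
      proof (cases "m \<le> N")
        case True
        then show ?thesis by blast
      next
        case False
        then show ?thesis using *[of m] by (simp only: Un_iff mem_cball_0 not_le simp_thms)
      qed
    qed
    moreover have "bounded ((\<lambda>n. d n /\<^sub>R t n) ` {..N} \<union> cball 0 (real (Suc k)))"
      by (simp add: finite_imp_bounded)
    ultimately show False
      using False bounded_subset by blast
  qed
  then obtain nx where nx: "\<And>N k. nx N k > N" "\<And>N k. real (Suc k) < norm (d (nx N k) /\<^sub>R t (nx N k))"
    by metis
  \<comment> \<open>Greedy choice: each index lies beyond the previous one, and the quotient at
    \<open>r n\<close> has norm above n + 1. This yields the bound 1/(n + 1) for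
    \<open>t / norm d\<close> below.\<close>
  define r where "r = rec_nat (nx 0 0) (\<lambda>n N. nx N (Suc n))"
  have r_Suc: "r (Suc n) = nx (r n) (Suc n)" for n
    by (simp add: r_def)
  have r: "strict_mono r"
    by (rule strict_monoI_Suc) (simp add: r_Suc nx)
  have big: "real (Suc n) < norm (d (r n) /\<^sub>R t (r n))" for n
  proof (cases n)
    case 0
    then show ?thesis using nx(2)[of 0 0] by (simp only: r_def nat.rec)
  next
    case (Suc m)
    then show ?thesis using nx(2)[where k=n and N="r m"] by (simp only: r_Suc)
  qed
  have dn: "d (r n) \<noteq> 0" for n
    using big[of n] by auto
  have "bounded (range (\<lambda>n. d (r n) /\<^sub>R norm (d (r n))))"
    by (rule boundedI[where B=1]) (auto simp: dn)
  then obtain u s where s: "strict_mono s" "((\<lambda>n. d (r n) /\<^sub>R norm (d (r n))) \<circ> s) \<longlonglongrightarrow> u"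
    using bounded_imp_convergent_subsequence by blast
  have u: "norm u = 1"
  proof -
    have "(\<lambda>n. norm (((\<lambda>n. d (r n) /\<^sub>R norm (d (r n))) \<circ> s) n)) \<longlonglongrightarrow> norm u"
      using s(2) by (rule tendsto_norm)
    moreover have "norm (((\<lambda>n. d (r n) /\<^sub>R norm (d (r n))) \<circ> s) n) = 1" for n
      using dn by simp
    ultimately show ?thesis
      by (simp add: LIMSEQ_const_iff)
  qed
  have "(\<lambda>n. t (r n) / norm (d (r n))) \<longlonglongrightarrow> 0"
  proof (rule tendsto_sandwich[OF _ _ tendsto_const LIMSEQ_inverse_real_of_nat])
    show "\<forall>\<^sub>F n in sequentially. 0 \<le> t (r n) / norm (d (r n))"
      using t by (simp add: less_imp_le)
    have "t (r n) / norm (d (r n)) \<le> inverse (real (Suc n))" for n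
    proof -
      have "real (Suc n) < norm (d (r n)) / t (r n)"
        using big[of n] t[of "r n"] by (simp add: divide_inverse mult.commute)
      then have "inverse (norm (d (r n)) / t (r n)) \<le> inverse (real (Suc n))"
        by (intro le_imp_inverse_le) auto
      then show ?thesis
        by (simp add: inverse_eq_divide)
    qed
    then show "\<forall>\<^sub>F n in sequentially. t (r n) / norm (d (r n)) \<le> inverse (real (Suc n))"
      by simp
  qed
  from LIMSEQ_subseq_LIMSEQ[OF this s(1)]
  have "(\<lambda>n. t ((r \<circ> s) n) / norm (d ((r \<circ> s) n))) \<longlonglongrightarrow> 0"
    by (simp only: o_def)
  moreover have "(\<lambda>n. d ((r \<circ> s) n) /\<^sub>R norm (d ((r \<circ> s) n))) \<longlonglongrightarrow> u"
    using s(2) by (simp only: o_def)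
  moreover have "d ((r \<circ> s) n) \<noteq> 0" for n
    using dn by simp
  ultimately show ?thesis
    using unbounded[OF strict_mono_o[OF r s(1)] u] by blast
qed

text \<open>The scale \<open>r\<close> is decoupled from the increments \<open>\<delta>\<close>, so
  the lemma serves both cases of the dichotomy, even when \<open>r n\<close> stays away from
  0.\<close>

lemma has_derivative_sequence:
  fixes f :: "'a::real_normed_vector \<Rightarrow> real"
  assumes f: "(f has_derivative f') (at a)"
    and \<delta>: "\<delta> \<longlonglongrightarrow> 0"
    and r: "\<And>n. 0 < r n"
    and lim: "(\<lambda>n. \<delta> n /\<^sub>R r n) \<longlonglongrightarrow> d"
  shows "(\<lambda>n. (f (a + \<delta> n) - f a) / r n) \<longlonglongrightarrow> f' d"
proof -
  interpret f': bounded_linear f' using f by (rule has_derivative_bounded_linear)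
  obtain e where e: "\<And>h. f (a + h) = f a + f' h + e h * norm h" "e 0 = 0" "e \<midarrow>0\<rightarrow> 0"
  proof -
    \<comment> \<open>Division by zero gives this relative remainder the value 0 at
      \<open>h = 0\<close>, which is exactly the value that makes it continuous there.\<close>
    let ?e = "\<lambda>h. (f (a + h) - f a - f' h) / norm h"
    have "(\<lambda>h. norm (?e h)) \<midarrow>0\<rightarrow> 0"
      using f unfolding has_derivative_at by (simp add: norm_divide)
    then have "?e \<midarrow>0\<rightarrow> 0"
      by (rule tendsto_norm_zero_cancel)
    with that[of ?e] show ?thesis
      by (simp add: f'.zero)
  qed
  have "(\<lambda>n. e (\<delta> n)) \<longlonglongrightarrow> 0"
  proof -
    have "isCont e 0" using e(2,3) by (simp add: isCont_def)
    from isCont_tendsto_compose[OF this \<delta>] show ?thesis by (simp add: e(2))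
  qed
  then have "(\<lambda>n. f' (\<delta> n /\<^sub>R r n) + e (\<delta> n) * norm (\<delta> n /\<^sub>R r n)) \<longlonglongrightarrow> f' d + 0 * norm d"
    by (intro tendsto_intros lim f'.tendsto)
  moreover have "f' (\<delta> n /\<^sub>R r n) + e (\<delta> n) * norm (\<delta> n /\<^sub>R r n) = (f (a + \<delta> n) - f a) / r n" for n
    using r[of n] unfolding e(1)
    by (simp add: f'.scaleR divide_inverse distrib_left mult.commute mult.left_commute)
  ultimately show ?thesis
    by simp
qed

text \<open>\<open>G\<close> is meant to be the square of a Banach-Minkowski norm; \<open>G'' v a w\<close> is the derivative of \<open>\<lambda>u. G' u w\<close>
  in direction \<open>a\<close>.\<close>

locale minkowski_square =
  fixes G :: "'a::euclidean_space \<Rightarrow> real" and G' :: "'a \<Rightarrow> 'a \<Rightarrow> real"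
    and G'' :: "'a \<Rightarrow> 'a \<Rightarrow> 'a \<Rightarrow> real"
  assumes homog: "0 < r \<Longrightarrow> G (r *\<^sub>R v) = r\<^sup>2 * G v"
    and pos: "v \<noteq> 0 \<Longrightarrow> 0 < G v"
    and deriv: "v \<noteq> 0 \<Longrightarrow> (G has_derivative G' v) (at v)"
    and deriv2: "v \<noteq> 0 \<Longrightarrow> ((\<lambda>u. G' u w) has_derivative (\<lambda>a. G'' v a w)) (at v)"
    and convex2: "v \<noteq> 0 \<Longrightarrow> w \<noteq> 0 \<Longrightarrow> 0 < G'' v w w"
begin

lemma zero [simp]: "G 0 = 0"
  using homog[of 2 0] by simp

lemma bl: "v \<noteq> 0 \<Longrightarrow> bounded_linear (G' v)"
  using deriv has_derivative_bounded_linear by blast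

lemma lin: "v \<noteq> 0 \<Longrightarrow> linear (G' v)"
  using bl bounded_linear.linear by blast

text \<open>The derivative is only available off the origin. At the origin, homogeneity of degree
  two bounds \<open>G u\<close> by a multiple of \<open>(norm u)\<^sup>2\<close>.\<close>

lemma isCont: "isCont G v"
proof (cases "v = 0")
  case False
  then show ?thesis using deriv has_derivative_continuous by blast
next
  case True
  have "compact (sphere (0::'a) 1)" "continuous_on (sphere (0::'a) 1) G"
    by (auto intro!: continuous_at_imp_continuous_on has_derivative_continuous[OF deriv])
  then have "bounded (G ` sphere 0 1)"
    by (intro compact_imp_bounded compact_continuous_image)
  then obtain C where "\<And>u. u \<in> sphere 0 1 \<Longrightarrow> norm (G u) \<le> C"
    by (metis bounded_iff imageI)
  then have C: "norm u = 1 \<Longrightarrow> norm (G u) \<le> C" for u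
    by simp
  have le: "norm (G u) \<le> (norm u)\<^sup>2 * C" for u
  proof (cases "u = 0")
    case False
    have "G u = (norm u)\<^sup>2 * G (u /\<^sub>R norm u)"
      using homog[of "norm u" "u /\<^sub>R norm u"] False by simp
    then show ?thesis using C[of "u /\<^sub>R norm u"] False by (simp add: abs_mult mult_left_mono)
  qed simp
  have "isCont (\<lambda>u::'a. (norm u)\<^sup>2 * C) 0"
    by (intro continuous_intros)
  then have "((\<lambda>u::'a. (norm u)\<^sup>2 * C) \<longlongrightarrow> (norm (0::'a))\<^sup>2 * C) (at 0)"
    unfolding isCont_def .
  then have "(G \<longlongrightarrow> 0) (at 0)"
    by (intro Lim_null_comparison[OF always_eventually[OF allI[OF le]]]) simp
  then show ?thesis using True by (simp add: isCont_def)
qed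

lemma euler: "v \<noteq> 0 \<Longrightarrow> G' v v = 2 * G v"
proof -
  assume v: "v \<noteq> 0"
  have "((\<lambda>r. G (r *\<^sub>R v)) has_derivative (\<lambda>h. G' (1 *\<^sub>R v) (h *\<^sub>R v))) (at 1)"
    by (rule has_derivative_compose[where g=G])
      (use v deriv in \<open>auto intro!: derivative_eq_intros\<close>)
  then have 1: "((\<lambda>r. G (r *\<^sub>R v)) has_derivative (\<lambda>h. h * G' v v)) (at 1)"
    using linear_scale[OF lin[OF v]] by simp
  have "((\<lambda>r. r\<^sup>2 * G v) has_derivative (\<lambda>h. h * (2 * G v))) (at (1::real))"
    by (auto intro!: derivative_eq_intros)
  then have "((\<lambda>r. G (r *\<^sub>R v)) has_derivative (\<lambda>h. h * (2 * G v))) (at 1)"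
    by (rule has_derivative_transform_within_open[where s="{0<..}"]) (auto simp: homog)
  from fun_cong[OF has_derivative_unique[OF 1 this], of 1] show ?thesis by simp
qed

text \<open>Continuity in the base point is known for each fixed direction only. Expanding the
  direction in the basis makes it joint, as required when both arguments vary in a limit.\<close>

lemma tendsto_deriv:
  assumes "(v \<longlongrightarrow> a) F" "(w \<longlongrightarrow> b) F" "a \<noteq> 0"
  shows "((\<lambda>n. G' (v n) (w n)) \<longlongrightarrow> G' a b) F"
proof -
  have expand: "G' u x = (\<Sum>i\<in>Basis. (x \<bullet> i) * G' u i)" if "u \<noteq> 0" for u x
  proof -
    have "G' u x = G' u (\<Sum>i\<in>Basis. (x \<bullet> i) *\<^sub>R i)" by (simp add: euclidean_representation)
    then show ?thesis by (simp add: linear_sum[OF lin[OF that]] linear_scale[OF lin[OF that]])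
  qed
  have "((\<lambda>n. \<Sum>i\<in>Basis. (w n \<bullet> i) * G' (v n) i) \<longlongrightarrow> (\<Sum>i\<in>Basis. (b \<bullet> i) * G' a i)) F"
  proof (intro tendsto_intros assms)
    fix i
    have "isCont (\<lambda>u. G' u i) a"
      using deriv2[OF assms(3)] has_derivative_continuous by blast
    then show "((\<lambda>n. G' (v n) i) \<longlongrightarrow> G' a i) F"
      using assms(1) by (rule isCont_tendsto_compose)
  qed
  moreover have "\<forall>\<^sub>F n in F. v n \<noteq> 0"
    using assms(1,3) tendsto_imp_eventually_ne by blast
  then have "\<forall>\<^sub>F n in F. (\<Sum>i\<in>Basis. (w n \<bullet> i) * G' (v n) i) = G' (v n) (w n)"
    by (rule eventually_mono) (rule expand[symmetric])
  ultimately show ?thesis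
    unfolding expand[OF assms(3), of b] by (rule Lim_transform_eventually)
qed

text \<open>Serves for restrictions to planes as well as for changes of coordinates that move a
  given plane to \<open>z = 0\<close>.\<close>

lemma compose_linear:
  assumes J: "linear J" "inj J"
  shows "minkowski_square (\<lambda>v. G (J v)) (\<lambda>v w. G' (J v) (J w)) (\<lambda>v a w. G'' (J v) (J a) (J w))"
proof
  have J0: "J v \<noteq> 0" if "v \<noteq> 0" for v
    using J that by (metis injD linear_0)
  have dJ: "(J has_derivative J) (at v)" for v
    using J(1) by (rule linear_imp_has_derivative)
  show "G (J (r *\<^sub>R v)) = r\<^sup>2 * G (J v)" if "0 < r" for r v
    using that by (simp add: linear_scale[OF J(1)] homog)
  show "0 < G (J v)" if "v \<noteq> 0" for v using J0 pos that by blast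
  show "0 < G'' (J v) (J w) (J w)" if "v \<noteq> 0" "w \<noteq> 0" for v w using J0 convex2 that by blast
  show "((\<lambda>v. G (J v)) has_derivative (\<lambda>w. G' (J v) (J w))) (at v)" if "v \<noteq> 0" for v
    by (rule has_derivative_compose[OF dJ deriv[OF J0[OF that]]])
  show "((\<lambda>v. G' (J v) (J w)) has_derivative (\<lambda>a. G'' (J v) (J a) (J w))) (at v)" if "v \<noteq> 0" for v w
    by (rule has_derivative_compose[OF dJ deriv2[OF J0[OF that]]])
qed

end


section \<open>Infinitesimal isometries of the plane\<close>

definition det2 :: "real^2 \<Rightarrow> real^2 \<Rightarrow> real" where
  "det2 s t = s$1 * t$2 - s$2 * t$1"

lemma det2_refl [simp]: "det2 s s = 0"
  by (simp add: det2_def)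

lemma det2_eq_0:
  assumes "s \<noteq> 0" "det2 s t = 0"
  obtains k where "t = k *\<^sub>R s"
proof
  have ss: "s$1 * s$1 + s$2 * s$2 \<noteq> 0"
    using assms(1) by (simp add: vec_eq_iff forall_2 sum_squares_eq_zero_iff)
  have eq: "s$1 * t$2 = s$2 * t$1"
    using assms(2) by (simp add: det2_def)
  have "(s$1 * s$1 + s$2 * s$2) * t$1 = (s$1 * t$1 + s$2 * t$2) * s$1"
       "(s$1 * s$1 + s$2 * s$2) * t$2 = (s$1 * t$1 + s$2 * t$2) * s$2"
    using eq by algebra+
  then show "t = ((s \<bullet> t) / (s \<bullet> s)) *\<^sub>R s"
    using ss by (simp add: vec_eq_iff forall_2 inner_vec_def sum_2 eq_divide_eq mult.commute)
qed

lemma det2_expand: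
  assumes "det2 s t \<noteq> 0"
  shows "u = (det2 u t / det2 s t) *\<^sub>R s + (det2 s u / det2 s t) *\<^sub>R t"
proof -
  have "det2 s t * u$1 = det2 u t * s$1 + det2 s u * t$1"
       "det2 s t * u$2 = det2 u t * s$2 + det2 s u * t$2"
    by (simp_all add: det2_def algebra_simps)
  then show ?thesis
    using assms by (simp add: vec_eq_iff forall_2 add_divide_distrib[symmetric] eq_divide_eq mult.commute)
qed

text \<open>Definiteness is left out of the notion: for the square of a norm it comes from
  positivity of the norm.\<close>

definition quadratic_form :: "('a::real_vector \<Rightarrow> real) \<Rightarrow> bool" where
  "quadratic_form N \<longleftrightarrow> (\<exists>B. bilinear B \<and> (\<forall>s t. B s t = B t s) \<and> (\<forall>s. N s = B s s))"

lemma quadratic_form_compose: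
  assumes "quadratic_form N" "linear L"
  shows "quadratic_form (\<lambda>s. N (L s))"
proof -
  obtain B where B: "bilinear B" "\<And>s t. B s t = B t s" "\<And>s. N s = B s s"
    using assms(1) unfolding quadratic_form_def by blast
  have "bilinear (\<lambda>s t. B (L s) (L t))"
    using B(1) linear_compose[OF assms(2), unfolded o_def] unfolding bilinear_def by blast
  then show ?thesis
    unfolding quadratic_form_def using B(2,3) by blast
qed

lemma mult_vec2: "(R *v s)$i = R$i$1 * s$1 + R$i$2 * s$2" for s :: "real^2"
  by (simp add: matrix_vector_mult_def sum_2)

text \<open>The quadratic form is \<open>det2 s (R *v s)\<close>: it is definite since an eigenvector of \<open>R\<close> would contradict
  Euler's relation, its derivative in direction \<open>R *v s\<close> is the trace times itself, and the trace vanishes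
  because the quotient of the form by \<open>N\<close> has a maximum.\<close>

lemma quadratic_form_if_linear_tangent:
  fixes R :: "real^2^2"
  assumes N: "minkowski_square N N' N''" and R: "R \<noteq> 0"
    and tang: "\<And>s. s \<noteq> 0 \<Longrightarrow> N' s (R *v s) = 0"
  shows "quadratic_form N"
proof -
  interpret N: minkowski_square N N' N'' by fact
  define q where "q s = det2 s (R *v s)" for s
  have q_ne: "q s \<noteq> 0" if s: "s \<noteq> 0" for s
  proof
    assume "q s = 0"
    then obtain k where k: "R *v s = k *\<^sub>R s"
      using det2_eq_0[OF s] unfolding q_def by blast
    have "k * (2 * N s) = 0"
      using tang[OF s] by (simp add: k linear_scale[OF N.lin[OF s]] N.euler[OF s])
    then have Rs: "R *v s = 0"
      using N.pos[OF s] k by auto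
    \<comment> \<open>Since \<open>R\<close> kills \<open>s\<close>, it has rank one with image
      spanned by \<open>w\<close>, the image of the quarter turn of \<open>s\<close> divided by the
      square of its length. The differential of \<open>N\<close> at every \<open>u\<close> off the
      line of \<open>s\<close> then kills \<open>w\<close>; reaching \<open>u = w\<close>
      contradicts Euler's relation.\<close>
    define w :: "real^2" where "w = (\<chi> i. (R$i$2 * s$1 - R$i$1 * s$2) / (s$1 * s$1 + s$2 * s$2))"
    have ss: "s$1 * s$1 + s$2 * s$2 \<noteq> 0"
      using s by (simp add: vec_eq_iff forall_2 sum_squares_eq_zero_iff)
    have Rw: "R *v u = det2 s u *\<^sub>R w" for u
    proof (rule vec_eq_iff[THEN iffD2], rule allI)
      fix i
      have "R$i$1 * s$1 + R$i$2 * s$2 = 0"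
        using Rs by (simp add: vec_eq_iff mult_vec2)
      then have "(R$i$1 * u$1 + R$i$2 * u$2) * (s$1 * s$1 + s$2 * s$2)
          = (s$1 * u$2 - s$2 * u$1) * (R$i$2 * s$1 - R$i$1 * s$2)"
        by algebra
      then show "(R *v u)$i = (det2 s u *\<^sub>R w)$i"
        using ss by (simp add: mult_vec2 w_def det2_def eq_divide_eq)
    qed
    have w: "w \<noteq> 0"
      using R matrix_eq[of R 0] by (auto simp: Rw)
    have Nw: "N' u w = 0" if u: "det2 s u \<noteq> 0" for u
    proof -
      have "u \<noteq> 0" using u by (auto simp: det2_def)
      then show ?thesis
        using tang[of u] u by (simp add: Rw linear_scale[OF N.lin])
    qed
    have "N' w w = 0"
    proof (cases "det2 s w = 0")
      case False
      then show ?thesis by (rule Nw)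
    next
      case True
      \<comment> \<open>The quarter turn of \<open>s\<close> pushes \<open>w\<close> off the line of
        \<open>s\<close>; continuity of the differential handles the limit.\<close>
      define v :: "real^2" where "v = vector [- s$2, s$1]"
      have "det2 s (w + inverse (real (Suc n)) *\<^sub>R v) \<noteq> 0" for n
      proof -
        have "det2 s (w + inverse (real (Suc n)) *\<^sub>R v)
            = det2 s w + inverse (real (Suc n)) * (s$1 * s$1 + s$2 * s$2)"
          by (simp add: det2_def v_def algebra_simps)
        then show ?thesis using ss True by simp
      qed
      then have "(\<lambda>n. N' (w + inverse (real (Suc n)) *\<^sub>R v) w) = (\<lambda>n. 0)"
        using Nw by blast
      moreover have "(\<lambda>n. w + inverse (real (Suc n)) *\<^sub>R v) \<longlonglongrightarrow> w + 0 *\<^sub>R v"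
        by (intro tendsto_intros LIMSEQ_inverse_real_of_nat)
      then have "(\<lambda>n. N' (w + inverse (real (Suc n)) *\<^sub>R v) w) \<longlonglongrightarrow> N' w w"
        using w by (intro N.tendsto_deriv) auto
      ultimately show ?thesis
        by (simp add: LIMSEQ_const_iff)
    qed
    then show False
      using N.euler[OF w] N.pos[OF w] by simp
  qed
  define dq where "dq s h = det2 h (R *v s) + det2 s (R *v h)" for s h
  have dq: "(q has_derivative dq s) (at s)" for s
  proof -
    have "(q has_derivative (\<lambda>h. (s$1 * (R *v h)$2 + h$1 * (R *v s)$2) - (s$2 * (R *v h)$1 + h$2 * (R *v s)$1))) (at s)"
      unfolding q_def[abs_def] det2_def
      by (intro derivative_intros bounded_linear.has_derivative[OF bounded_linear_vec_nth]
          bounded_linear.has_derivative[OF matrix_vector_mul_bounded_linear] has_derivative_ident)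
    moreover have "(\<lambda>h. (s$1 * (R *v h)$2 + h$1 * (R *v s)$2) - (s$2 * (R *v h)$1 + h$2 * (R *v s)$1)) = dq s"
      by (simp add: fun_eq_iff dq_def det2_def)
    ultimately show ?thesis by simp
  qed
  define D where "D s h = (dq s h * N s - q s * N' s h) / (N s * N s)" for s h
  have D: "((\<lambda>s. q s / N s) has_derivative D s) (at s)" if "s \<noteq> 0" for s
    unfolding D_def[abs_def] using that N.pos[OF that]
    by (intro has_derivative_divide' dq N.deriv) auto
  have dq_R: "dq s (R *v s) = (R$1$1 + R$2$2) * q s" for s
    by (simp add: dq_def q_def det2_def mult_vec2 algebra_simps)
  have q_scale: "q (r *\<^sub>R s) = r\<^sup>2 * q s" for r s
    by (simp add: q_def det2_def mult_vec2 power2_eq_square algebra_simps)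
  have "compact (sphere (0::real^2) 1)" "sphere (0::real^2) 1 \<noteq> {}"
    by (auto simp: sphere_eq_empty)
  moreover have "continuous_on (sphere (0::real^2) 1) (\<lambda>s. q s / N s)"
  proof (intro continuous_at_imp_continuous_on ballI)
    fix s :: "real^2" assume "s \<in> sphere 0 1"
    then have "s \<noteq> 0" by auto
    from D[OF this] show "isCont (\<lambda>s. q s / N s) s"
      by (rule has_derivative_continuous)
  qed
  ultimately obtain m where m: "norm m = 1" and max1: "\<And>s. norm s = 1 \<Longrightarrow> q s / N s \<le> q m / N m"
    using continuous_attains_sup[of "sphere (0::real^2) 1" "\<lambda>s. q s / N s"] by auto
  have m0: "m \<noteq> 0" using m by auto
  have max: "q s / N s \<le> q m / N m" if "s \<noteq> 0" for s
    using max1[of "inverse (norm s) *\<^sub>R s"] that by (simp add: q_scale N.homog)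
  have "D m = (\<lambda>h. 0)"
    by (rule differential_zero_maxmin[where S="- {0}", OF _ _ D[OF m0]]) (use m0 max in auto)
  then have "D m (R *v m) = 0" by simp
  then have trace: "R$1$1 + R$2$2 = 0"
    using N.pos[OF m0] q_ne[OF m0] by (simp add: D_def dq_R tang[OF m0])
  \<comment> \<open>The vectors \<open>s\<close> and \<open>R *v s\<close> span the plane because
    \<open>q s\<close> is nonzero. The derivative of the quotient kills the first since
    \<open>q\<close> and \<open>N\<close> have the same degree, and the second since the trace is
    zero.\<close>
  have D0: "D s = (\<lambda>h. 0)" if s: "s \<noteq> 0" for s
  proof
    fix h
    have l: "linear (D s)"
      using D[OF s] by (rule has_derivative_linear)
    have "dq s s = 2 * q s" by (simp add: dq_def q_def)
    then have 1: "D s s = 0" using N.euler[OF s] by (simp add: D_def)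
    have 2: "D s (R *v s) = 0" by (simp add: D_def dq_R trace tang[OF s])
    have "h = (det2 h (R *v s) / q s) *\<^sub>R s + (det2 s h / q s) *\<^sub>R (R *v s)"
      unfolding q_def by (rule det2_expand) (use q_ne[OF s] in \<open>simp add: q_def\<close>)
    moreover have "D s (a *\<^sub>R s + b *\<^sub>R (R *v s)) = 0" for a b
      by (simp add: linear_add[OF l] linear_scale[OF l] 1 2)
    ultimately show "D s h = 0" by metis
  qed
  have conn: "connected (- {0::real^2})"
    by (rule connected_punctured_universe) simp
  define c where "c = q m / N m"
  have c: "q s = c * N s" for s
  proof (cases "s = 0")
    case True
    then show ?thesis by (simp add: q_def det2_def)
  next
    case False
    have "q s / N s = q m / N m"
      by (rule has_derivative_zero_unique_connected[where s="- {0}" and f="\<lambda>s. q s / N s"])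
        (use conn D D0 False m0 in auto)
    then show ?thesis using N.pos[OF False] by (simp add: c_def field_simps)
  qed
  have c0: "c \<noteq> 0"
    using c[of m] q_ne[OF m0] by auto
  \<comment> \<open>Polarization of \<open>q\<close>, divided by the constant ratio
    \<open>c\<close>.\<close>
  define B where "B s t = (det2 s (R *v t) + det2 t (R *v s)) / (2 * c)" for s t
  have "bilinear B"
    unfolding bilinear_def
    by (intro conjI allI linearI; simp add: B_def det2_def mult_vec2 add_divide_distrib[symmetric] diff_divide_distrib[symmetric]; simp add: algebra_simps)
  moreover have "B s t = B t s" for s t by (simp add: B_def)
  moreover have "N s = B s s" for s using c[of s] c0 by (simp add: B_def q_def)
  ultimately show ?thesis unfolding quadratic_form_def by blast
qed


section \<open>Isometric planes near a given plane\<close>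

lemma (in minkowski_square) two_sided_bound:
  obtains c C where "0 < c" "\<And>v. c * (norm v)\<^sup>2 \<le> G v" "\<And>v. G v \<le> C * (norm v)\<^sup>2"
proof -
  have "compact (sphere (0::'a) 1)" "sphere (0::'a) 1 \<noteq> {}" "continuous_on (sphere (0::'a) 1) G"
    by (auto simp: sphere_eq_empty isCont intro!: continuous_at_imp_continuous_on)
  from continuous_attains_inf[OF this] continuous_attains_sup[OF this]
  obtain a b where ab: "norm a = 1" "\<And>v. norm v = 1 \<Longrightarrow> G a \<le> G v" "\<And>v. norm v = 1 \<Longrightarrow> G v \<le> G b"
    unfolding Ball_def Bex_def mem_sphere_0 by blast
  have scale: "G v = (norm v)\<^sup>2 * G (v /\<^sub>R norm v)" "norm (v /\<^sub>R norm v) = 1" if "v \<noteq> 0" for v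
    using homog[of "norm v" "v /\<^sub>R norm v"] that by simp_all
  show ?thesis
  proof (rule that[of "G a" "G b"])
    show "0 < G a" using ab(1) by (intro pos) auto
    show "G a * (norm v)\<^sup>2 \<le> G v" for v
      using scale[of v] ab(2)[of "v /\<^sub>R norm v"] by (cases "v = 0") (simp_all add: mult.commute mult_left_mono)
    show "G v \<le> G b * (norm v)\<^sup>2" for v
      using scale[of v] ab(3)[of "v /\<^sub>R norm v"] by (cases "v = 0") (simp_all add: mult.commute mult_left_mono)
  qed
qed

lemma tendsto_linear:
  fixes L :: "'a::euclidean_space \<Rightarrow> 'b::real_normed_vector"
  assumes "linear L" "(f \<longlongrightarrow> a) F"
  shows "((\<lambda>n. L (f n)) \<longlongrightarrow> L a) F"
  using assms bounded_linear.tendsto linear_conv_bounded_linear by blast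

lemma tendsto_matrix_vector_left:
  fixes M :: "'n \<Rightarrow> real^'k^'m"
  assumes "(M \<longlongrightarrow> A) F"
  shows "((\<lambda>n. M n *v s) \<longlongrightarrow> A *v s) F"
  by (rule tendsto_linear[OF _ assms])
    (auto intro!: linearI simp: matrix_vector_mult_add_rdistrib scaleR_matrix_vector_assoc)

lemma tendsto_matrix_mult_left:
  fixes M :: "'n \<Rightarrow> real^'k^'m" and W :: "real^'l^'k"
  assumes "(M \<longlongrightarrow> A) F"
  shows "((\<lambda>n. M n ** W) \<longlongrightarrow> A ** W) F"
  by (rule tendsto_linear[OF _ assms])
    (auto intro!: linearI simp: matrix_matrix_mult_def vec_eq_iff sum.distrib[symmetric] sum_distrib_left algebra_simps)

lemma bounded_matrices:
  fixes M :: "'n \<Rightarrow> real^2^2"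
  assumes "\<And>n s. norm (M n *v s) \<le> K * norm s"
  shows "bounded (range M)"
proof (rule boundedI)
  fix A assume "A \<in> range M"
  then obtain n where A: "A = M n" by blast
  have entry: "\<bar>A$i$j\<bar> \<le> K" for i j
  proof -
    have "A$i$j = (A *v axis j 1)$i"
      by (simp add: matrix_vector_mul_component inner_axis)
    then have "\<bar>A$i$j\<bar> \<le> norm (A *v axis j 1)"
      using component_le_norm_cart[of "A *v axis j 1" i] by simp
    also have "\<dots> \<le> K"
      using assms[of n "axis j 1"] by (simp add: A)
    finally show ?thesis .
  qed
  have "norm A \<le> (\<Sum>i\<in>UNIV. norm (A$i))"
    by (simp add: norm_vec_def L2_set_le_sum)
  also have "\<dots> \<le> (\<Sum>i\<in>(UNIV::2 set). \<Sum>j\<in>(UNIV::2 set). \<bar>A$i$j\<bar>)"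
    by (intro sum_mono norm_le_l1_cart)
  also have "\<dots> \<le> (\<Sum>i\<in>(UNIV::2 set). \<Sum>j\<in>(UNIV::2 set). K)"
    by (intro sum_mono entry)
  finally show "norm A \<le> 4 * K"
    by (simp add: sum_2)
qed

lemma minkowski_square_slice:
  assumes "minkowski_square G G' G''"
  shows "minkowski_square (\<lambda>s::real^2. G (s, 0::real)) (\<lambda>s w. G' (s, 0) (w, 0)) (\<lambda>s a w. G'' (s, 0) (a, 0) (w, 0))"
proof -
  interpret minkowski_square G G' G'' by fact
  show ?thesis
    by (rule compose_linear[of "\<lambda>s. (s, 0)"]) (auto intro!: linearI injI)
qed

text \<open>The derivatives at \<open>t = 0\<close> of a family of isometries from the plane \<open>z = 0\<close> to the planes
  \<open>z = t * (\<mu> \<bullet> s)\<close> may fail to exist. If the difference quotients are unbounded, their normalized limit is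
  an infinitesimal isometry of the plane \<open>z = 0\<close>.\<close>

lemma first_variation:
  fixes G :: "(real^2) \<times> real \<Rightarrow> real" and M :: "nat \<Rightarrow> real^2^2" and \<mu> :: "real^2"
  assumes G: "minkowski_square G G' G''"
    and t: "\<And>n. 0 < t n" "t \<longlonglongrightarrow> 0"
    and M: "\<And>n s. G (M n *v s, t n * (\<mu> \<bullet> (M n *v s))) = G (s, 0)"
    and nq: "\<not> quadratic_form (\<lambda>s. G (s, 0))"
  obtains R :: "real^2^2" where "\<And>s. s \<noteq> 0 \<Longrightarrow> G' (s, 0) (R *v s, \<mu> \<bullet> s) = 0"
proof -
  interpret minkowski_square G G' G'' by fact
  obtain c C where c: "0 < c" "\<And>v. c * (norm v)\<^sup>2 \<le> G v" and C: "\<And>v. G v \<le> C * (norm v)\<^sup>2"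
    using two_sided_bound by metis
  have "norm (M n *v s) \<le> sqrt (C / c) * norm s" for n s
  proof -
    have "norm (M n *v s) \<le> norm (M n *v s, t n * (\<mu> \<bullet> (M n *v s)))"
      by (simp add: norm_Pair real_le_rsqrt)
    then have "(norm (M n *v s))\<^sup>2 \<le> (norm (M n *v s, t n * (\<mu> \<bullet> (M n *v s))))\<^sup>2"
      by (intro power_mono) auto
    then have "c * (norm (M n *v s))\<^sup>2 \<le> c * (norm (M n *v s, t n * (\<mu> \<bullet> (M n *v s))))\<^sup>2"
      using c by (intro mult_left_mono) auto
    also have "\<dots> \<le> G (s, 0)"
      using c(2) by (simp only: M[symmetric, of _ n])
    also have "\<dots> \<le> C * (norm s)\<^sup>2"
      using C[of "(s, 0)"] by simp
    finally have "(norm (M n *v s))\<^sup>2 \<le> (C / c) * (norm s)\<^sup>2"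
      using c(1) by (simp add: field_simps)
    from real_le_rsqrt[OF this] have "norm (M n *v s) \<le> sqrt ((C / c) * (norm s)\<^sup>2)" .
    also have "\<dots> = sqrt (C / c) * norm s"
      by (simp only: real_sqrt_mult real_sqrt_abs abs_norm_cancel)
    finally show ?thesis .
  qed
  then have "bounded (range M)"
    by (rule bounded_matrices)
  then obtain r M0 where r: "strict_mono r" and M0: "(\<lambda>n. M (r n)) \<longlonglongrightarrow> M0"
    using bounded_imp_convergent_subsequence unfolding o_def by blast
  have tr: "(\<lambda>n. t (r n)) \<longlonglongrightarrow> 0"
    using LIMSEQ_subseq_LIMSEQ[OF t(2) r] by (simp add: o_def)
  have GM0: "G (M0 *v s, 0) = G (s, 0)" for s
  proof -
    have "(\<lambda>n. (M (r n) *v s, t (r n) * (\<mu> \<bullet> (M (r n) *v s)))) \<longlonglongrightarrow> (M0 *v s, 0 * (\<mu> \<bullet> (M0 *v s)))"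
      by (intro tendsto_intros tr tendsto_matrix_vector_left M0)
    from isCont_tendsto_compose[OF isCont this] show ?thesis
      by (simp add: M LIMSEQ_const_iff)
  qed
  have "s = 0" if "M0 *v s = 0" for s
  proof (rule ccontr)
    assume "s \<noteq> 0"
    then have "G (s, 0) > 0" using pos by (simp add: zero_prod_def)
    moreover have "G (s, 0) = 0" using GM0[of s] that zero by (simp add: zero_prod_def)
    ultimately show False by simp
  qed
  then have "invertible M0"
    unfolding invertible_left_inverse matrix_left_invertible_ker by blast
  then obtain W where W: "M0 ** W = mat 1"
    unfolding invertible_def by blast
  \<comment> \<open>Precomposition with the inverse \<open>W\<close> of the limit isometry makes the
    family converge to the identity. \<open>D\<close> is the deviation from it, and
    \<open>\<delta> s\<close> below is the displacement of \<open>(s, 0)\<close>, along which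
    \<open>G\<close> keeps its value.\<close>
  define D where "D n = M (r n) ** W - mat 1" for n
  have D0: "D \<longlonglongrightarrow> 0"
  proof -
    have "(\<lambda>n. M (r n) ** W - mat 1) \<longlonglongrightarrow> M0 ** W - mat 1"
      by (intro tendsto_intros tendsto_matrix_mult_left M0)
    then show ?thesis by (simp add: D_def[abs_def] W)
  qed
  define \<delta> where "\<delta> s n = (D n *v s, t (r n) * (\<mu> \<bullet> (s + D n *v s)))" for s n
  have \<delta>: "G ((s, 0) + \<delta> s n) = G (s, 0)" for s n
  proof -
    have 1: "s + D n *v s = M (r n) *v (W *v s)"
      by (simp add: D_def matrix_vector_mult_diff_rdistrib matrix_vector_mul_assoc)
    have "G ((s, 0) + \<delta> s n) = G (W *v s, 0)"
      unfolding \<delta>_def add_Pair 1 using M[of "r n" "W *v s"] by simp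
    also have "\<dots> = G (M0 *v (W *v s), 0)"
      by (simp only: GM0)
    finally show ?thesis
      by (simp add: matrix_vector_mul_assoc W)
  qed
  have \<delta>0: "\<delta> s \<longlonglongrightarrow> 0" for s
  proof -
    have "(\<lambda>n. (D n *v s, t (r n) * (\<mu> \<bullet> (s + D n *v s)))) \<longlonglongrightarrow> (0 *v s, 0 * (\<mu> \<bullet> (s + 0 *v s)))"
      by (intro tendsto_intros tr tendsto_matrix_vector_left D0)
    then show ?thesis by (simp add: \<delta>_def[abs_def] zero_prod_def)
  qed
  \<comment> \<open>One limit for both cases of the dichotomy: the scale \<open>x = t\<close> leads
    to \<open>k = 1\<close>, the scale \<open>norm D\<close> to \<open>k = 0\<close>.\<close>
  have key: "G' (s, 0) (B *v s, k * (\<mu> \<bullet> s)) = 0"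
    if s: "s \<noteq> 0" and k: "strict_mono k'" and x: "\<And>n. 0 < x n"
      and B: "(\<lambda>n. D (k' n) /\<^sub>R x n) \<longlonglongrightarrow> B" and tx: "(\<lambda>n. t (r (k' n)) / x n) \<longlonglongrightarrow> k"
    for s B k k' x
  proof -
    have dG: "(G has_derivative G' (s, 0)) (at (s, 0))"
      using s by (intro deriv) (simp add: zero_prod_def)
    have \<delta>k: "(\<lambda>n. \<delta> s (k' n)) \<longlonglongrightarrow> 0"
      using LIMSEQ_subseq_LIMSEQ[OF \<delta>0 k] by (simp add: o_def)
    have Dk: "(\<lambda>n. D (k' n)) \<longlonglongrightarrow> 0"
      using LIMSEQ_subseq_LIMSEQ[OF D0 k] by (simp add: o_def)
    have "(\<lambda>n. ((D (k' n) /\<^sub>R x n) *v s, t (r (k' n)) / x n * (\<mu> \<bullet> (s + D (k' n) *v s))))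
        \<longlonglongrightarrow> (B *v s, k * (\<mu> \<bullet> (s + 0 *v s)))"
      by (intro tendsto_intros tx tendsto_matrix_vector_left B Dk)
    then have "(\<lambda>n. \<delta> s (k' n) /\<^sub>R x n) \<longlonglongrightarrow> (B *v s, k * (\<mu> \<bullet> s))"
      by (simp add: \<delta>_def scaleR_matrix_vector_assoc[symmetric] divide_inverse mult_ac)
    from has_derivative_sequence[OF dG \<delta>k x this] show ?thesis
      by (simp add: \<delta> LIMSEQ_const_iff)
  qed
  show ?thesis
  proof (rule blowup_dichotomy[of "\<lambda>n. t (r n)" D])
    fix k B assume k: "strict_mono k" "(\<lambda>n. D (k n) /\<^sub>R t (r (k n))) \<longlonglongrightarrow> B"
    have "G' (s, 0) (B *v s, 1 * (\<mu> \<bullet> s)) = 0" if "s \<noteq> 0" for s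
      by (rule key[OF that k(1) t(1) k(2)]) (use t(1) in \<open>simp add: less_imp_neq[symmetric]\<close>)
    then show thesis using that[of B] by simp
  next
    fix k u assume k: "strict_mono k" and u: "norm u = 1" and D: "\<And>n. D (k n) \<noteq> 0"
      "(\<lambda>n. D (k n) /\<^sub>R norm (D (k n))) \<longlonglongrightarrow> u" "(\<lambda>n. t (r (k n)) / norm (D (k n))) \<longlonglongrightarrow> 0"
    have "G' (s, 0) (u *v s, 0 * (\<mu> \<bullet> s)) = 0" if "s \<noteq> 0" for s
      by (rule key[OF that k _ D(2,3)]) (simp add: D(1))
    then have "quadratic_form (\<lambda>s. G (s, 0))"
      using u by (intro quadratic_form_if_linear_tangent[OF minkowski_square_slice[OF G], of u]) auto
    then show thesis using nq by simp
  qed (use t tr in auto)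
qed

section \<open>Cylinders touching the unit sphere along a plane section\<close>

text \<open>The linear factor depends on the zero \<open>(x, y)\<close> alone, not on the
  coefficients. Hence two quadratic forms with a common zero share it, which is how it is split off
  a planar quadratic vector field.\<close>

lemma homogeneous_quadratic_factor:
  fixes x y :: real
  assumes "a * x\<^sup>2 + b * x * y + c * y\<^sup>2 = 0" and "x\<^sup>2 + y\<^sup>2 = 1"
  obtains \<alpha> \<beta> where "\<And>u v. a * u\<^sup>2 + b * u * v + c * v\<^sup>2 = (x * v - y * u) * (\<alpha> * u + \<beta> * v)"
proof
  \<comment> \<open>In the orthonormal basis \<open>(x, y)\<close>, \<open>(- y, x)\<close> the form
    has first diagonal entry 0; \<open>?S\<close> is its off-diagonal entry and \<open>?T\<close>
    its second diagonal entry.\<close>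
  let ?S = "- a * x * y + b * (x\<^sup>2 - y\<^sup>2) / 2 + c * x * y" and ?T = "a * y\<^sup>2 - b * x * y + c * x\<^sup>2"
  fix u v
  define S where "S = ?S"
  have S: "2 * S = - 2 * a * x * y + b * (x\<^sup>2 - y\<^sup>2) + 2 * c * x * y"
    by (simp add: S_def field_simps)
  show "a * u\<^sup>2 + b * u * v + c * v\<^sup>2
      = (x * v - y * u) * ((2 * x * ?S - y * ?T) * u + (2 * y * ?S + x * ?T) * v)"
    unfolding S_def[symmetric] using S assms by algebra
qed

text \<open>The intermediate value theorem on a half circle, whose end points are opposite and so
  carry opposite values.\<close>

lemma odd_function_zero_on_circle:
  fixes g :: "real^2 \<Rightarrow> real"
  assumes cont: "continuous_on UNIV g" and odd: "\<And>s. g (- s) = - g s"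
  obtains s where "(s$1)\<^sup>2 + (s$2)\<^sup>2 = 1" "g s = 0"
proof -
  define p :: "real \<Rightarrow> real^2" where "p \<theta> = cos \<theta> *\<^sub>R axis 1 1 + sin \<theta> *\<^sub>R axis 2 1" for \<theta>
  have "continuous_on {0..pi} (\<lambda>\<theta>. g (p \<theta>))"
    unfolding p_def by (intro continuous_on_compose2[OF cont] continuous_intros) auto
  moreover have "g (p pi) = - g (p 0)"
    using odd[of "p 0"] by (simp add: p_def)
  ultimately obtain \<theta> where "g (p \<theta>) = 0"
    using IVT'[of "\<lambda>\<theta>. g (p \<theta>)" 0 0 pi] IVT2'[of "\<lambda>\<theta>. g (p \<theta>)" pi 0 0] by force
  moreover have "(p \<theta> $ 1)\<^sup>2 + (p \<theta> $ 2)\<^sup>2 = 1"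
    by (simp add: p_def axis_def)
  ultimately show ?thesis using that by blast
qed

text \<open>The conclusion says that the unit sphere is touched along its section by the plane \<open>z = 0\<close> by a
  cylinder with direction \<open>(\<epsilon>, 1)\<close>. First variations \<open>R1\<close>, \<open>R2\<close> in the two coordinate directions give the
  quadratic vector field \<open>Q\<close> tangent to the unit circle. The cubic \<open>det2 s (Q s)\<close> has a zero, at which \<open>Q\<close>
  vanishes by Euler's relation, so \<open>Q\<close> is a linear form times a linear field \<open>R\<close>, and \<open>R = 0\<close> because the
  section is not an ellipse.\<close>

lemma quadratic_or_cylinder:
  fixes G :: "(real^2) \<times> real \<Rightarrow> real"
  assumes G: "minkowski_square G G' G''" and \<delta>: "0 < \<delta>"
    and iso: "\<And>l::real^2. norm l < \<delta> \<Longrightarrow> \<exists>M::real^2^2. \<forall>s. G (M *v s, l \<bullet> (M *v s)) = G (s, 0)"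
    and nq: "\<not> quadratic_form (\<lambda>s. G (s, 0))"
  obtains \<epsilon> :: "real^2" where "\<And>s. s \<noteq> 0 \<Longrightarrow> G' (s, 0) (\<epsilon>, 1) = 0"
proof -
  interpret minkowski_square G G' G'' by fact
  have nz: "(s, 0) \<noteq> 0" if "s \<noteq> 0" for s :: "real^2"
    using that by (simp add: zero_prod_def)
  have "\<exists>R::real^2^2. \<forall>s. s \<noteq> 0 \<longrightarrow> G' (s, 0) (R *v s, s$i) = 0" for i
  proof -
    \<comment> \<open>Starting with the denominator 2 keeps already the first slope strictly below
      \<open>\<delta>\<close>.\<close>
    define t where "t n = \<delta> * inverse (real (Suc (Suc n)))" for n
    have t: "0 < t n" "t n < \<delta>" for n
    proof -
      have "inverse (real (Suc (Suc n))) < 1" by (simp add: inverse_less_1_iff)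
      from mult_strict_left_mono[OF this \<delta>] show "t n < \<delta>" by (simp add: t_def)
      show "0 < t n" using \<delta> by (simp add: t_def)
    qed
    have t0: "t \<longlonglongrightarrow> 0"
      unfolding t_def by (intro tendsto_mult_right_zero LIMSEQ_Suc LIMSEQ_inverse_real_of_nat)
    have "\<exists>M::real^2^2. \<forall>s. G (M *v s, t n * (axis i 1 \<bullet> (M *v s))) = G (s, 0)" for n
      using iso[of "t n *\<^sub>R axis i 1"] t[of n] by simp
    then obtain M :: "nat \<Rightarrow> real^2^2"
      where M: "\<And>n s. G (M n *v s, t n * (axis i 1 \<bullet> (M n *v s))) = G (s, 0)"
      by metis
    obtain R :: "real^2^2" where "\<And>s. s \<noteq> 0 \<Longrightarrow> G' (s, 0) (R *v s, axis i 1 \<bullet> s) = 0"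
      using first_variation[OF G t(1) t0 M nq] by blast
    then show ?thesis by (auto simp: inner_axis' intro!: exI[of _ R])
  qed
  then obtain R1 R2 :: "real^2^2"
    where R1: "\<And>s. s \<noteq> 0 \<Longrightarrow> G' (s, 0) (R1 *v s, s$1) = 0"
      and R2: "\<And>s. s \<noteq> 0 \<Longrightarrow> G' (s, 0) (R2 *v s, s$2) = 0"
    by metis
  \<comment> \<open>The combination in which the \<open>z\<close>-components \<open>s$1\<close> and
    \<open>s$2\<close> of the two variations cancel.\<close>
  define Q where "Q s = s$2 *\<^sub>R (R1 *v s) - s$1 *\<^sub>R (R2 *v s)" for s
  have Q: "G' (s, 0) (Q s, 0) = 0" if s: "s \<noteq> 0" for s
  proof -
    have "(Q s, 0) = s$2 *\<^sub>R (R1 *v s, s$1) - s$1 *\<^sub>R (R2 *v s, s$2)"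
      by (simp add: Q_def)
    then have "G' (s, 0) (Q s, 0) = s$2 * G' (s, 0) (R1 *v s, s$1) - s$1 * G' (s, 0) (R2 *v s, s$2)"
      by (simp only: linear_diff[OF lin[OF nz[OF s]]] linear_scale[OF lin[OF nz[OF s]]] real_scaleR_def)
    then show ?thesis
      by (simp only: R1[OF s] R2[OF s])
  qed
  have Q_vec: "Q s $ i = - R2$i$1 * (s$1)\<^sup>2 + (R1$i$1 - R2$i$2) * s$1 * s$2 + R1$i$2 * (s$2)\<^sup>2" for s i
    by (simp add: Q_def mult_vec2 power2_eq_square algebra_simps)
  obtain s0 where s0: "(s0$1)\<^sup>2 + (s0$2)\<^sup>2 = 1" "det2 s0 (Q s0) = 0"
  proof (rule odd_function_zero_on_circle[of "\<lambda>s. det2 s (Q s)"])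
    show "continuous_on UNIV (\<lambda>s. det2 s (Q s))"
      unfolding det2_def Q_vec by (intro continuous_intros)
    show "det2 (- s) (Q (- s)) = - det2 s (Q s)" for s
      by (simp add: det2_def Q_vec)
  qed
  have s0_nz: "s0 \<noteq> 0" using s0(1) by auto
  obtain k where k: "Q s0 = k *\<^sub>R s0"
    using det2_eq_0[OF s0_nz s0(2)] .
  have "(Q s0, 0::real) = k *\<^sub>R (s0, 0)" using k by simp
  then have "G' (s0, 0) (Q s0, 0) = k * (2 * G (s0, 0))"
    by (simp only: linear_scale[OF lin[OF nz[OF s0_nz]]] euler[OF nz[OF s0_nz]] real_scaleR_def)
  then have "k * (2 * G (s0, 0)) = 0"
    by (simp only: Q[OF s0_nz])
  then have "Q s0 = 0"
    using pos[OF nz[OF s0_nz]] k by simp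
  then have "- R2$i$1 * (s0$1)\<^sup>2 + (R1$i$1 - R2$i$2) * s0$1 * s0$2 + R1$i$2 * (s0$2)\<^sup>2 = 0" for i
    using Q_vec[of s0 i] by simp
  then have "\<exists>\<alpha> \<beta>. \<forall>u v. - R2$i$1 * u\<^sup>2 + (R1$i$1 - R2$i$2) * u * v + R1$i$2 * v\<^sup>2
      = (s0$1 * v - s0$2 * u) * (\<alpha> * u + \<beta> * v)" for i
    using homogeneous_quadratic_factor[OF _ s0(1)] by metis
  then obtain \<alpha> \<beta> where ab: "\<And>i u v. - R2$i$1 * u\<^sup>2 + (R1$i$1 - R2$i$2) * u * v + R1$i$2 * v\<^sup>2
      = (s0$1 * v - s0$2 * u) * (\<alpha> i * u + \<beta> i * v)"
    by metis
  define R :: "real^2^2" where "R = (\<chi> i. vector [\<alpha> i, \<beta> i])"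
  have QR: "Q s = det2 s0 s *\<^sub>R (R *v s)" for s
    unfolding vec_eq_iff Q_vec ab by (simp add: mult_vec2 R_def det2_def)
  have tang: "G' (s, 0) (R *v s, 0) = 0" if s: "s \<noteq> 0" "det2 s0 s \<noteq> 0" for s
  proof -
    have "(Q s, 0::real) = det2 s0 s *\<^sub>R (R *v s, 0)" by (simp add: QR)
    then have "G' (s, 0) (Q s, 0) = det2 s0 s * G' (s, 0) (R *v s, 0)"
      by (simp only: linear_scale[OF lin[OF nz[OF s(1)]]] real_scaleR_def)
    then show ?thesis
      using s(2) by (simp add: Q[OF s(1)])
  qed
  have "R = 0"
  proof (rule ccontr)
    assume R: "R \<noteq> 0"
    have "G' (s, 0) (R *v s, 0) = 0" if s: "s \<noteq> 0" for s
    proof (cases "det2 s0 s = 0")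
      case False
      then show ?thesis using tang s by blast
    next
      case True
      define v :: "real^2" where "v = vector [- s0$2, s0$1]"
      define u where "u n = s + inverse (real (Suc n)) *\<^sub>R v" for n
      have "det2 s0 (u n) = inverse (real (Suc n))" for n
      proof -
        have "det2 s0 (u n) = det2 s0 s + inverse (real (Suc n)) * ((s0$1)\<^sup>2 + (s0$2)\<^sup>2)"
          by (simp add: u_def v_def det2_def power2_eq_square algebra_simps)
        then show ?thesis using True s0(1) by simp
      qed
      then have "det2 s0 (u n) \<noteq> 0" for n by simp
      moreover from this have "u n \<noteq> 0" for n
        by (metis det2_def diff_0_right mult_zero_right zero_index)
      ultimately have "(\<lambda>n. G' (u n, 0) (R *v u n, 0)) = (\<lambda>n. 0)"
        using tang by blast
      moreover have "u \<longlonglongrightarrow> s + 0 *\<^sub>R v"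
        unfolding u_def by (intro tendsto_intros LIMSEQ_inverse_real_of_nat)
      then have "u \<longlonglongrightarrow> s" by simp
      then have "(\<lambda>n. G' (u n, 0) (R *v u n, 0)) \<longlonglongrightarrow> G' (s, 0) (R *v s, 0)"
        by (intro tendsto_deriv tendsto_Pair tendsto_const nz s
            bounded_linear.tendsto[OF matrix_vector_mul_bounded_linear])
      ultimately show ?thesis by (simp add: LIMSEQ_const_iff)
    qed
    then have "quadratic_form (\<lambda>s. G (s, 0))"
      by (rule quadratic_form_if_linear_tangent[OF minkowski_square_slice[OF G] R])
    then show False using nq by simp
  qed
  then have Q0: "Q s = 0" for s
    by (simp add: QR)
  define w where "w = (\<chi> i. R1$i$1)"
  \<comment> \<open>A quadratic form that vanishes at these three vectors has zero coefficients.
    Therefore \<open>R1\<close> and \<open>R2\<close> are multiplication of one vector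
    \<open>w\<close> by the first and second coordinate; at least one coordinate of a nonzero
    \<open>s\<close> can be cancelled.\<close>
  have co: "R2$i$1 = 0" "R1$i$2 = 0" "R2$i$2 = R1$i$1" for i
    using Q_vec[of "axis 1 1" i] Q_vec[of "axis 2 1" i] Q_vec[of "axis 1 1 + axis 2 1" i]
    by (simp_all add: Q0 axis_def)
  have Rw: "R1 *v s = s$1 *\<^sub>R w" "R2 *v s = s$2 *\<^sub>R w" for s
    by (simp_all add: vec_eq_iff mult_vec2 co w_def)
  have "G' (s, 0) (w, 1) = 0" if s: "s \<noteq> 0" for s
  proof -
    have "G' (s, 0) (s$1 *\<^sub>R (w, 1)) = 0" "G' (s, 0) (s$2 *\<^sub>R (w, 1)) = 0"
      using R1[OF s] R2[OF s] by (simp_all add: Rw)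
    then have "s$1 * G' (s, 0) (w, 1) = 0" "s$2 * G' (s, 0) (w, 1) = 0"
      by (simp_all only: linear_scale[OF lin[OF nz[OF s]]] real_scaleR_def)
    then show ?thesis using s by (auto simp: vec_eq_iff forall_2)
  qed
  then show ?thesis using that by blast
qed

text \<open>The shear \<open>J\<close> carries \<open>z = 0\<close> to
  \<open>z = l \<bullet> s\<close> and adds \<open>l\<close> to the slopes of planes, so the
  hypotheses hold again around the new plane with radius \<open>\<delta> - norm l\<close>.\<close>

lemma cylinder_over_nearby_plane:
  fixes G :: "(real^2) \<times> real \<Rightarrow> real" and l :: "real^2"
  assumes G: "minkowski_square G G' G''"
    and iso: "\<And>l::real^2. norm l < \<delta> \<Longrightarrow> \<exists>M::real^2^2. \<forall>s. G (M *v s, l \<bullet> (M *v s)) = G (s, 0)"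
    and nq: "\<not> quadratic_form (\<lambda>s. G (s, 0))" and l: "norm l < \<delta>"
  obtains \<epsilon> :: "real^2" where "\<And>s. s \<noteq> 0 \<Longrightarrow> G' (s, l \<bullet> s) (\<epsilon>, 1 + l \<bullet> \<epsilon>) = 0"
proof -
  interpret minkowski_square G G' G'' by fact
  define J :: "(real^2) \<times> real \<Rightarrow> (real^2) \<times> real" where "J v = (fst v, snd v + l \<bullet> fst v)" for v
  have J: "linear J" "inj J"
    by (auto simp: J_def inner_add_right algebra_simps intro!: linearI injI prod_eqI)
  have Js: "J (s, z) = (s, z + l \<bullet> s)" for s z by (simp add: J_def)
  obtain M where M: "\<And>s. G (M *v s, l \<bullet> (M *v s)) = G (s, 0)"
    using iso[OF l] by blast
  have "s = 0" if "M *v s = 0" for s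
  proof (rule ccontr)
    assume "s \<noteq> 0"
    then have "G (s, 0) > 0" using pos by (simp add: zero_prod_def)
    moreover have "G (s, 0) = 0" using M[of s] that zero by (simp add: zero_prod_def)
    ultimately show False by simp
  qed
  then have "invertible M"
    unfolding invertible_left_inverse matrix_left_invertible_ker by blast
  then obtain W where W: "M ** W = mat 1"
    unfolding invertible_def by blast
  have GW: "G (W *v s, 0) = G (s, l \<bullet> s)" for s
    using M[of "W *v s"] by (simp add: matrix_vector_mul_assoc W)
  obtain \<epsilon> where \<epsilon>: "\<And>s. s \<noteq> 0 \<Longrightarrow> G' (J (s, 0)) (J (\<epsilon>, 1)) = 0"
  proof (rule quadratic_or_cylinder[OF compose_linear[OF J], of "\<delta> - norm l"])
    show "0 < \<delta> - norm l" using l by simp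
    show "\<exists>M'::real^2^2. \<forall>s. G (J (M' *v s, m \<bullet> (M' *v s))) = G (J (s, 0))"
      if m: "norm m < \<delta> - norm l" for m :: "real^2"
    proof -
      have "norm (l + m) < \<delta>" using m norm_triangle_ineq[of l m] by simp
      then obtain M2 where M2: "\<And>s. G (M2 *v s, (l + m) \<bullet> (M2 *v s)) = G (s, 0)"
        using iso by blast
      \<comment> \<open>\<open>W\<close> leads isometrically from the plane of slope
        \<open>l\<close> back to \<open>z = 0\<close>, and \<open>M2\<close> from there to the plane
        of slope \<open>l + m\<close>.\<close>
      have "G (J ((M2 ** W) *v s, m \<bullet> ((M2 ** W) *v s))) = G (J (s, 0))" for s
        using M2[of "W *v s"]
        by (simp add: Js GW matrix_vector_mul_assoc[symmetric] inner_add_left add.commute)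
      then show ?thesis by blast
    qed
    show "\<not> quadratic_form (\<lambda>s. G (J (s, 0)))"
    proof
      assume "quadratic_form (\<lambda>s. G (J (s, 0)))"
      from quadratic_form_compose[OF this matrix_vector_mul_linear[of M]]
      show False using nq by (simp add: Js M)
    qed
  qed blast
  then show ?thesis using that[of \<epsilon>] by (simp add: Js)
qed

text \<open>The direction \<open>\<epsilon> l\<close> of the cylinder over the plane \<open>z = l \<bullet> s\<close> is differentiated at \<open>l = 0\<close>.
  Difference quotients again replace the derivative, and the unbounded case contradicts Euler's relation.
  The two partial derivatives combine to a linear vector field tangent to the unit circle.\<close>

theorem isometric_planes_imp_quadratic:
  fixes G :: "(real^2) \<times> real \<Rightarrow> real"
  assumes G: "minkowski_square G G' G''" and \<delta>: "0 < \<delta>"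
    and iso: "\<And>l::real^2. norm l < \<delta> \<Longrightarrow> \<exists>M::real^2^2. \<forall>s. G (M *v s, l \<bullet> (M *v s)) = G (s, 0)"
  shows "quadratic_form (\<lambda>s. G (s, 0))"
proof (rule ccontr)
  assume nq: "\<not> ?thesis"
  interpret minkowski_square G G' G'' by fact
  have nz: "(s, z) \<noteq> 0" if "s \<noteq> 0" for s :: "real^2" and z :: real
    using that by (simp add: zero_prod_def)
  have "\<exists>\<epsilon>::real^2. \<forall>s. s \<noteq> 0 \<longrightarrow> G' (s, l \<bullet> s) (\<epsilon>, 1 + l \<bullet> \<epsilon>) = 0" if "norm l < \<delta>" for l
    using cylinder_over_nearby_plane[OF G iso nq that] by metis
  then obtain \<epsilon> :: "real^2 \<Rightarrow> real^2"
    where \<epsilon>: "\<And>l s. norm l < \<delta> \<Longrightarrow> s \<noteq> 0 \<Longrightarrow> G' (s, l \<bullet> s) (\<epsilon> l, 1 + l \<bullet> \<epsilon> l) = 0"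
    by metis
  define e0 where "e0 = \<epsilon> 0"
  define H where "H a = G' a (e0, 1)" for a
  define K where "K s = G'' (s, 0) (e0, 1) (e0, 1)" for s
  have H0: "H (s, 0) = 0" if "s \<noteq> 0" for s
    using \<epsilon>[of 0 s] that \<delta> by (simp add: H_def e0_def)
  have dH: "(H has_derivative (\<lambda>a. G'' (s, 0) a (e0, 1))) (at (s, 0))" if "s \<noteq> 0" for s
    unfolding H_def[abs_def] by (rule deriv2[OF nz[OF that]])
  have K: "0 < K s" if "s \<noteq> 0" for s
    unfolding K_def by (rule convex2[OF nz[OF that]]) (simp add: zero_prod_def)
  have G''z: "G'' (s, 0) (0, z) (e0, 1) = z * K s" if s: "s \<noteq> 0" for s z
  proof -
    have "((\<lambda>s. (s, 0::real)) has_derivative (\<lambda>w. (w, 0))) (at s)"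
      by (auto intro!: derivative_eq_intros)
    from has_derivative_compose[OF this dH[OF s]]
    have 1: "((\<lambda>s. H (s, 0)) has_derivative (\<lambda>w. G'' (s, 0) (w, 0) (e0, 1))) (at s)" .
    have "((\<lambda>s. H (s, 0)) has_derivative (\<lambda>w. 0)) (at s)"
      by (rule has_derivative_transform_within_open[OF has_derivative_const, where s="- {0}"])
        (use s H0 in auto)
    from has_derivative_unique[OF 1 this] have "G'' (s, 0) (w, 0) (e0, 1) = 0" for w
      by (rule fun_cong)
    moreover have l: "linear (\<lambda>a. G'' (s, 0) a (e0, 1))"
      by (rule has_derivative_linear[OF dH[OF s]])
    \<comment> \<open>As \<open>H\<close> vanishes on the plane \<open>z = 0\<close>, its derivative
      ignores horizontal vectors, so a vertical vector may be replaced by a multiple of the cylinder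
      direction.\<close>
    have "(0, z) = z *\<^sub>R (e0, 1) + (- (z *\<^sub>R e0), 0)" by simp
    then have "G'' (s, 0) (0, z) (e0, 1) = z * K s + G'' (s, 0) (- (z *\<^sub>R e0), 0) (e0, 1)"
      by (simp only: linear_add[OF l] linear_scale[OF l] K_def real_scaleR_def)
    ultimately show ?thesis by simp
  qed
  \<comment> \<open>Formally, differentiating the cylinder condition in the \<open>i\<close>-th
    slope gives two terms: \<open>s$i * K s\<close> from the moving base point, and the differential
    of \<open>G\<close> applied to the derivative of the direction.\<close>
  have "\<exists>C. \<forall>s. s \<noteq> 0 \<longrightarrow> G' (s, 0) (C, 0) = - s$i * K s" for i
  proof -
    define t where "t n = \<delta> * inverse (real (Suc (Suc n)))" for n
    have t: "0 < t n" "t n < \<delta>" for n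
    proof -
      have "inverse (real (Suc (Suc n))) < 1" by (simp add: inverse_less_1_iff)
      from mult_strict_left_mono[OF this \<delta>] show "t n < \<delta>" by (simp add: t_def)
      show "0 < t n" using \<delta> by (simp add: t_def)
    qed
    have t0: "t \<longlonglongrightarrow> 0"
      unfolding t_def by (intro tendsto_mult_right_zero LIMSEQ_Suc LIMSEQ_inverse_real_of_nat)
    define d where "d n = \<epsilon> (t n *\<^sub>R axis i 1) - e0" for n
    have eq: "G' (s, t n * s$i) (d n, t n * d n$i) + H (s, t n * s$i) + t n * e0$i * G' (s, t n * s$i) (0, 1) = 0"
      if s: "s \<noteq> 0" for s n
    proof -
      have "G' (s, t n * s$i) (\<epsilon> (t n *\<^sub>R axis i 1), 1 + t n * \<epsilon> (t n *\<^sub>R axis i 1)$i) = 0"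
        using \<epsilon>[of "t n *\<^sub>R axis i 1" s] t[of n] s by (simp add: inner_axis')
      moreover have "(\<epsilon> (t n *\<^sub>R axis i 1), 1 + t n * \<epsilon> (t n *\<^sub>R axis i 1)$i)
          = (d n, t n * d n$i) + (e0, 1) + (t n * e0$i) *\<^sub>R (0, 1)"
        by (simp add: d_def algebra_simps)
      ultimately show ?thesis
        by (simp only: H_def linear_add[OF lin[OF nz[OF s]]] linear_scale[OF lin[OF nz[OF s]]] real_scaleR_def)
    qed
    have key: "G' (s, 0) (B, 0) + \<tau> * (s$i * K s) + \<tau> * e0$i * G' (s, 0) (0, 1) = 0"
      if s: "s \<noteq> 0" and k: "strict_mono k" and x: "\<And>n. 0 < x n"
        and B: "(\<lambda>n. d (k n) /\<^sub>R x n) \<longlonglongrightarrow> B" and \<tau>: "(\<lambda>n. t (k n) / x n) \<longlonglongrightarrow> \<tau>"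
      for s B k x \<tau>
    proof -
      have tk: "(\<lambda>n. t (k n)) \<longlonglongrightarrow> 0"
        using LIMSEQ_subseq_LIMSEQ[OF t0 k] by (simp add: o_def)
      have a: "(\<lambda>n. (s, t (k n) * s$i)) \<longlonglongrightarrow> (s, 0)"
        by (intro tendsto_Pair tendsto_const tendsto_mult_left_zero tk)
      have "(\<lambda>n. (H ((s, 0) + (0, t (k n) * s$i)) - H (s, 0)) / x n) \<longlonglongrightarrow> G'' (s, 0) (0, \<tau> * s$i) (e0, 1)"
      proof (rule has_derivative_sequence[OF dH[OF s] _ x])
        have "(\<lambda>n. (0, t (k n) * s$i)) \<longlonglongrightarrow> (0::real^2, 0)"
          by (intro tendsto_Pair tendsto_const tendsto_mult_left_zero tk)
        then show "(\<lambda>n. (0::real^2, t (k n) * s$i)) \<longlonglongrightarrow> 0"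
          by (simp add: zero_prod_def)
        have "(\<lambda>n. (0::real^2, t (k n) / x n * s$i)) \<longlonglongrightarrow> (0, \<tau> * s$i)"
          by (intro tendsto_intros \<tau>)
        then show "(\<lambda>n. (0::real^2, t (k n) * s$i) /\<^sub>R x n) \<longlonglongrightarrow> (0, \<tau> * s$i)"
          by (simp add: divide_inverse mult_ac)
      qed
      then have h: "(\<lambda>n. H (s, t (k n) * s$i) / x n) \<longlonglongrightarrow> \<tau> * (s$i * K s)"
        by (simp add: H0[OF s] G''z[OF s] mult.assoc)
      have "(\<lambda>n. (d (k n) /\<^sub>R x n, t (k n) * (d (k n) /\<^sub>R x n)$i)) \<longlonglongrightarrow> (B, 0 * B$i)"
        by (intro tendsto_intros B tk)
      then have dx: "(\<lambda>n. (d (k n), t (k n) * d (k n)$i) /\<^sub>R x n) \<longlonglongrightarrow> (B, 0)"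
        by (simp add: mult_ac)
      have "(\<lambda>n. G' (s, t (k n) * s$i) ((d (k n), t (k n) * d (k n)$i) /\<^sub>R x n) + H (s, t (k n) * s$i) / x n
            + t (k n) / x n * e0$i * G' (s, t (k n) * s$i) (0, 1))
          \<longlonglongrightarrow> G' (s, 0) (B, 0) + \<tau> * (s$i * K s) + \<tau> * e0$i * G' (s, 0) (0, 1)"
        by (intro tendsto_add tendsto_mult tendsto_const tendsto_deriv a dx h \<tau> nz[OF s])
      moreover have "G' (s, t (k n) * s$i) ((d (k n), t (k n) * d (k n)$i) /\<^sub>R x n) + H (s, t (k n) * s$i) / x n
            + t (k n) / x n * e0$i * G' (s, t (k n) * s$i) (0, 1) = 0" for n
      proof -
        have "inverse (x n) * (G' (s, t (k n) * s$i) (d (k n), t (k n) * d (k n)$i) + H (s, t (k n) * s$i)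
            + t (k n) * e0$i * G' (s, t (k n) * s$i) (0, 1)) = 0"
          by (simp only: eq[OF s] mult_zero_right)
        then show ?thesis
          unfolding linear_scale[OF lin[OF nz[OF s]]]
          by (simp only: real_scaleR_def divide_inverse distrib_left mult_ac)
      qed
      ultimately show ?thesis by (simp only: LIMSEQ_const_iff)
    qed
    show ?thesis
    proof (rule blowup_dichotomy[of t d])
      fix k B assume k: "strict_mono k" "(\<lambda>n. d (k n) /\<^sub>R t (k n)) \<longlonglongrightarrow> B"
      have "G' (s, 0) (B - e0$i *\<^sub>R e0, 0) = - s$i * K s" if s: "s \<noteq> 0" for s
      proof -
        have 1: "G' (s, 0) (B, 0) + 1 * (s$i * K s) + 1 * e0$i * G' (s, 0) (0, 1) = 0"
          by (rule key[OF s k(1) t(1) k(2)]) (use t(1) in \<open>simp add: less_imp_neq[symmetric]\<close>)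
        \<comment> \<open>Subtracting a multiple of \<open>(e0, 1)\<close>, on which the
          differential vanishes, makes the varied direction horizontal.\<close>
        have "(B - e0$i *\<^sub>R e0, 0) = (B, 0) + e0$i *\<^sub>R (0, 1) - e0$i *\<^sub>R (e0, 1::real)"
          by simp
        then have "G' (s, 0) (B - e0$i *\<^sub>R e0, 0) = G' (s, 0) (B, 0) + e0$i * G' (s, 0) (0, 1) - e0$i * H (s, 0)"
          by (simp only: H_def linear_add[OF lin[OF nz[OF s]]] linear_diff[OF lin[OF nz[OF s]]]
              linear_scale[OF lin[OF nz[OF s]]] real_scaleR_def)
        then show ?thesis using 1 H0[OF s] by simp
      qed
      then show ?thesis by blast
    next
      fix k u assume k: "strict_mono k" and u: "norm u = 1" and d: "\<And>n. d (k n) \<noteq> 0"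
        "(\<lambda>n. d (k n) /\<^sub>R norm (d (k n))) \<longlonglongrightarrow> u" "(\<lambda>n. t (k n) / norm (d (k n))) \<longlonglongrightarrow> 0"
      have u0: "u \<noteq> 0" using u by auto
      \<comment> \<open>The limit \<open>u\<close> is a constant field killed by the differential at
        every \<open>s\<close>; the choice \<open>s = u\<close> is the one excluded by
        Euler.\<close>
      have "G' (u, 0) (u, 0) + 0 * (u$i * K u) + 0 * e0$i * G' (u, 0) (0, 1) = 0"
        by (rule key[OF u0 k _ d(2,3)]) (simp add: d(1))
      then show ?thesis
        using euler[OF nz[OF u0]] pos[OF nz[OF u0], of 0] by simp
    qed (use t t0 in auto)
  qed
  then obtain C where C: "\<And>i s. s \<noteq> 0 \<Longrightarrow> G' (s, 0) (C i, 0) = - s$i * K s"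
    by metis
  \<comment> \<open>Chosen so that the two \<open>K\<close> terms cancel. If \<open>R\<close> were
    0, then \<open>C 1\<close> would be 0, and its equation at the first basis vector would violate
    \<open>K > 0\<close>.\<close>
  define R :: "real^2^2" where "R = (\<chi> j. vector [- C 2$j, C 1$j])"
  have R: "R *v s = s$2 *\<^sub>R C 1 - s$1 *\<^sub>R C 2" for s
    by (simp add: vec_eq_iff mult_vec2 R_def)
  have "G' (s, 0) (R *v s, 0) = 0" if s: "s \<noteq> 0" for s
  proof -
    have "(R *v s, 0) = s$2 *\<^sub>R (C 1, 0) - s$1 *\<^sub>R (C 2, 0::real)" by (simp add: R)
    then have "G' (s, 0) (R *v s, 0) = s$2 * G' (s, 0) (C 1, 0) - s$1 * G' (s, 0) (C 2, 0)"
      by (simp only: linear_diff[OF lin[OF nz[OF s]]] linear_scale[OF lin[OF nz[OF s]]] real_scaleR_def)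
    then show ?thesis by (simp add: C[OF s])
  qed
  moreover have "R \<noteq> 0"
  proof
    assume "R = 0"
    then have "C 1 = 0" using R[of "axis 2 1"] by (simp add: axis_def)
    moreover have ax: "axis 1 1 \<noteq> (0::real^2)" by (simp add: axis_eq_0_iff)
    ultimately have "G' (axis 1 1, 0) 0 = - K (axis 1 1)"
      using C[OF ax, of 1] by (simp add: axis_def zero_prod_def)
    then show False
      using K[OF ax] linear_0[OF lin[OF nz[OF ax]]] by simp
  qed
  ultimately have "quadratic_form (\<lambda>s. G (s, 0))"
    by (intro quadratic_form_if_linear_tangent[OF minkowski_square_slice[OF G]])
  then show False using nq by simp
qed


section \<open>Surfaces in a Banach-Minkowski space\<close>

text \<open>The product rule transfers two derivatives from the norm to its square, for which
  convexity is stated.\<close>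

lemma banach_minkowski_norm_square:
  fixes \<Phi> :: "'v::euclidean_space \<Rightarrow> real"
  assumes "banach_minkowski_norm \<Phi>"
  obtains Q' Q'' where "minkowski_square (\<lambda>v. (\<Phi> v)\<^sup>2) Q' Q''"
proof -
  have norm: "minkowski_norm_on UNIV \<Phi>" and sm: "smooth_on (- {0}) \<Phi>"
    and pd: "\<And>v w. v \<noteq> 0 \<Longrightarrow> w \<noteq> 0 \<Longrightarrow> 0 < second_differential (\<lambda>u. (\<Phi> u)\<^sup>2) v w w"
    using assms unfolding banach_minkowski_norm_def by blast+
  have C2: "Cn_on (Suc (Suc 0)) (- {0}) \<Phi>"
    using sm unfolding smooth_on_def by blast
  define Q where "Q v = (\<Phi> v)\<^sup>2" for v
  define F where "F v = frechet_derivative \<Phi> (at v)" for v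
  have dPhi: "(\<Phi> has_derivative F v) (at v)" if "v \<noteq> 0" for v
    using C2 that unfolding F_def by (auto simp: frechet_derivative_works[symmetric])
  have dF: "(\<lambda>u. F u w) differentiable at v" if "v \<noteq> 0" for v w
    using C2 that unfolding F_def by auto
  have dQ: "(Q has_derivative (\<lambda>w. 2 * \<Phi> v * F v w)) (at v)" if "v \<noteq> 0" for v
    unfolding Q_def[abs_def]
    by (rule has_derivative_eq_rhs[OF has_derivative_power[OF dPhi[OF that]]]) (auto simp: fun_eq_iff)
  have Q': "frechet_derivative Q (at v) = (\<lambda>w. 2 * \<Phi> v * F v w)" if "v \<noteq> 0" for v
    using frechet_derivative_at[OF dQ[OF that]] by simp
  have "minkowski_square Q (\<lambda>v. frechet_derivative Q (at v)) (second_differential Q)"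
  proof
    show "Q (r *\<^sub>R v) = r\<^sup>2 * Q v" if "0 < r" for r v
      using norm that by (simp add: minkowski_norm_on_def Q_def power_mult_distrib)
    show "0 < Q v" if "v \<noteq> 0" for v
      using norm that by (auto simp: minkowski_norm_on_def Q_def zero_less_power)
    show "(Q has_derivative frechet_derivative Q (at v)) (at v)" if "v \<noteq> 0" for v
      using dQ[OF that] by (simp add: Q'[OF that])
    show "0 < second_differential Q v w w" if "v \<noteq> 0" "w \<noteq> 0" for v w
      using pd[OF that] by (simp add: Q_def[abs_def])
    show "((\<lambda>u. frechet_derivative Q (at u) w) has_derivative (\<lambda>a. second_differential Q v a w)) (at v)"
      if v: "v \<noteq> 0" for v w
    proof -
      obtain F2 where F2: "((\<lambda>u. F u w) has_derivative F2) (at v)"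
        using dF[OF v] unfolding differentiable_def by blast
      have "((\<lambda>u. 2 * \<Phi> u * F u w) has_derivative (\<lambda>a. 2 * \<Phi> v * F2 a + 2 * F v a * F v w)) (at v)"
        by (rule has_derivative_eq_rhs, (rule derivative_intros dPhi[OF v] F2)+) (simp add: fun_eq_iff)
      then have "((\<lambda>u. frechet_derivative Q (at u) w) has_derivative
          (\<lambda>a. 2 * \<Phi> v * F2 a + 2 * F v a * F v w)) (at v)"
        by (rule has_derivative_transform_within_open[where s="- {0}"]) (use v in \<open>auto simp: Q'\<close>)
      then have "(\<lambda>u. frechet_derivative Q (at u) w) differentiable at v"
        unfolding differentiable_def by blast
      then show ?thesis
        unfolding second_differential_def by (simp add: frechet_derivative_works)
    qed
  qed
  then show ?thesis using that by (simp add: Q_def[abs_def])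
qed

lemma vec2_expand: "w = w$1 *\<^sub>R axis 1 1 + w$2 *\<^sub>R axis 2 (1::real)" for w :: "real^2"
  by (simp add: vec_eq_iff forall_2 axis_def)

text \<open>In the coordinates \<open>(s, z) \<mapsto> D x0 s + z *\<^sub>R e\<close> the range of \<open>D x\<close> is the plane \<open>z = l x \<bullet> s\<close>, where
  \<open>l x\<close> is given by Cramer's rule. Nondegeneracy makes the derivative of \<open>l\<close> at \<open>x0\<close> invertible, hence
  \<open>l\<close> attains all values near \<open>0\<close>.\<close>

lemma quadratic_form_on_nondegenerate_plane:
  fixes D :: "real^2 \<Rightarrow> real^2 \<Rightarrow> 'v::euclidean_space" and \<pi> :: "'v \<Rightarrow> real"
  assumes Q: "minkowski_square Q Q' Q''"
    and U: "open U" "x0 \<in> U"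
    and D: "\<And>x. x \<in> U \<Longrightarrow> linear (D x)" "\<And>x w. x \<in> U \<Longrightarrow> (\<lambda>y. D y w) differentiable at x"
    and D0: "inj (D x0)"
    and D2: "\<And>w. ((\<lambda>y. D y w) has_derivative (\<lambda>v. D2 v w)) (at x0)"
    and \<pi>: "linear \<pi>" "surj \<pi>" "{v. \<pi> v = 0} = range (D x0)"
    and nondeg: "\<And>v. v \<noteq> 0 \<Longrightarrow> \<exists>w. \<pi> (D2 v w) \<noteq> 0"
    and iso: "\<And>x. x \<in> U \<Longrightarrow> \<exists>L. linear L \<and> (\<forall>s. Q (D x (L s)) = Q (D x0 s))"
  shows "quadratic_form (\<lambda>s. Q (D x0 s))"
proof -
  obtain e where e: "\<pi> e = 1" using \<pi>(2) by (metis surjD)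
  note lD0 = D(1)[OF U(2)]
  have \<pi>D0: "\<pi> (D x0 s) = 0" for s using \<pi>(3) by blast
  obtain \<rho>0 where \<rho>0: "linear \<rho>0" "\<And>s. \<rho>0 (D x0 s) = s"
    using linear_injective_left_inverse[OF lD0 D0] by (auto simp: fun_eq_iff)
  \<comment> \<open>Projection along the transversal \<open>e\<close>, read in the parameters of the
    base plane; \<open>(\<rho> v, \<pi> v)\<close> are the coordinates of \<open>v\<close> inverse
    to \<open>J\<close>.\<close>
  define \<rho> where "\<rho> v = \<rho>0 (v - \<pi> v *\<^sub>R e)" for v
  have l\<rho>: "linear \<rho>"
    unfolding \<rho>_def
    by (rule linearI)
      (simp_all add: linear_add[OF \<pi>(1)] linear_scale[OF \<pi>(1)] linear_diff[OF \<rho>0(1)] linear_add[OF \<rho>0(1)]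
        linear_scale[OF \<rho>0(1)] algebra_simps)
  define J where "J a = D x0 (fst a) + snd a *\<^sub>R e" for a
  have J_\<rho>: "J (\<rho> v, \<pi> v) = v" for v
  proof -
    have "\<pi> (v - \<pi> v *\<^sub>R e) = 0"
      by (simp add: linear_diff[OF \<pi>(1)] linear_scale[OF \<pi>(1)] e)
    then obtain s where "v - \<pi> v *\<^sub>R e = D x0 s" using \<pi>(3) by blast
    then show ?thesis by (simp add: J_def \<rho>_def \<rho>0) (metis diff_add_cancel)
  qed
  have lJ: "linear J"
    unfolding J_def by (rule linearI) (simp_all add: linear_add[OF lD0] linear_scale[OF lD0] algebra_simps)
  have iJ: "inj J"
  proof (rule injI)
    fix a b assume ab: "J a = J b"
    have "\<pi> (J c) = snd c" for c
      by (simp add: J_def linear_add[OF \<pi>(1)] linear_scale[OF \<pi>(1)] \<pi>D0 e)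
    then have "snd a = snd b" using ab by metis
    then show "a = b" using ab D0 by (auto simp: J_def prod_eq_iff dest: injD)
  qed
  \<comment> \<open>\<open>p\<close> is the horizontal part of \<open>D x\<close> in these
    coordinates and \<open>h\<close> its height. Where the determinant \<open>\<Delta>\<close> of
    \<open>p\<close> is nonzero, the range of \<open>D x\<close> is a graph; at \<open>x0\<close> it
    equals 1.\<close>
  define p where "p i j x = \<rho> (D x (axis j 1)) $ i" for i j :: 2 and x
  define h where "h j x = \<pi> (D x (axis j 1))" for j :: 2 and x
  define \<Delta> where "\<Delta> x = p 1 1 x * p 2 2 x - p 1 2 x * p 2 1 x" for x
  define \<alpha> where "\<alpha> x = (h 1 x * p 2 2 x - h 2 x * p 2 1 x) / \<Delta> x" for x
  define \<beta> where "\<beta> x = (h 2 x * p 1 1 x - h 1 x * p 1 2 x) / \<Delta> x" for x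
  define l :: "real^2 \<Rightarrow> real^2" where "l x = \<alpha> x *\<^sub>R axis 1 1 + \<beta> x *\<^sub>R axis 2 1" for x
  have bl: "bounded_linear (\<lambda>v. \<rho> v $ i)" "bounded_linear \<pi>" for i
    using bounded_linear_compose[OF bounded_linear_vec_nth linear_linear[THEN iffD2, OF l\<rho>]] \<pi>(1)
    by (auto simp: linear_linear)
  have dif: "p i j differentiable at x" "h j differentiable at x" if "x \<in> U" for i j x
    using D(2)[OF that] bounded_linear.has_derivative[OF bl(1)] bounded_linear.has_derivative[OF bl(2)]
    unfolding p_def[abs_def] h_def[abs_def] differentiable_def by blast+
  have cont: "continuous_on U (p i j)" "continuous_on U (h j)" for i j
    by (intro continuous_at_imp_continuous_on ballI differentiable_imp_continuous_within dif; assumption)+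
  define S where "S = {x \<in> U. \<Delta> x \<noteq> 0}"
  have S: "open S"
  proof -
    have "continuous_on U \<Delta>" unfolding \<Delta>_def by (intro continuous_intros cont)
    then have "open (U \<inter> \<Delta> -` (- {0}))" using U(1) by (intro continuous_open_preimage) auto
    moreover have "U \<inter> \<Delta> -` (- {0}) = S" by (auto simp: S_def)
    ultimately show ?thesis by simp
  qed
  have at0: "p i j x0 = (if i = j then 1 else 0)" "h j x0 = 0" for i j
    by (simp_all add: p_def h_def \<rho>_def \<pi>D0 \<rho>0(2) axis_def)
  have \<Delta>0: "\<Delta> x0 = 1" by (simp add: \<Delta>_def at0)
  have x0S: "x0 \<in> S" using U(2) by (simp add: S_def \<Delta>0)
  have l_cont: "continuous_on S l"
    unfolding l_def \<alpha>_def \<beta>_def \<Delta>_def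
    by (intro continuous_intros continuous_on_subset[OF cont(1), of S] continuous_on_subset[OF cont(2), of S])
      (auto simp: S_def \<Delta>_def)
  have dh: "(h j has_derivative (\<lambda>v. \<pi> (D2 v (axis j 1)))) (at x0)" for j
    unfolding h_def[abs_def] by (rule bounded_linear.has_derivative[OF bl(2) D2])
  obtain dp where dp: "\<And>i j. (p i j has_derivative dp i j) (at x0)"
    using dif(1)[OF U(2)] unfolding differentiable_def by metis
  obtain d\<Delta> where d\<Delta>: "(\<Delta> has_derivative d\<Delta>) (at x0)"
  proof -
    have "\<Delta> differentiable at x0"
      unfolding \<Delta>_def by (intro derivative_intros dif U)
    then show ?thesis using that unfolding differentiable_def by blast
  qed
  define l' :: "real^2 \<Rightarrow> real^2"
    where "l' v = \<pi> (D2 v (axis 1 1)) *\<^sub>R axis 1 1 + \<pi> (D2 v (axis 2 1)) *\<^sub>R axis 2 1" for v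
  \<comment> \<open>At \<open>x0\<close> the heights vanish and \<open>p\<close> is the identity, so
    the unspecified derivatives \<open>dp\<close> and \<open>d\<Delta>\<close> only occur multiplied
    by 0.\<close>
  have "(\<alpha> has_derivative (\<lambda>v. \<pi> (D2 v (axis 1 1)))) (at x0)"
    unfolding \<alpha>_def
    by (rule has_derivative_eq_rhs, (rule derivative_intros dh dp d\<Delta>)+) (auto simp: \<Delta>0 at0)
  moreover have "(\<beta> has_derivative (\<lambda>v. \<pi> (D2 v (axis 2 1)))) (at x0)"
    unfolding \<beta>_def
    by (rule has_derivative_eq_rhs, (rule derivative_intros dh dp d\<Delta>)+) (auto simp: \<Delta>0 at0)
  ultimately have dl: "(l has_derivative l') (at x0)"
    unfolding l_def l'_def by (intro has_derivative_add has_derivative_scaleR_left)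
  have ll': "linear l'"
    using dl by (rule has_derivative_linear)
  have D2_expand: "D2 v w = w$1 *\<^sub>R D2 v (axis 1 1) + w$2 *\<^sub>R D2 v (axis 2 1)" for v w
  proof -
    have "((\<lambda>y. w$1 *\<^sub>R D y (axis 1 1) + w$2 *\<^sub>R D y (axis 2 1)) has_derivative
        (\<lambda>v. w$1 *\<^sub>R D2 v (axis 1 1) + w$2 *\<^sub>R D2 v (axis 2 1))) (at x0)"
      by (intro has_derivative_add has_derivative_scaleR_right D2)
    then have "((\<lambda>y. D y w) has_derivative
        (\<lambda>v. w$1 *\<^sub>R D2 v (axis 1 1) + w$2 *\<^sub>R D2 v (axis 2 1))) (at x0)"
    proof (rule has_derivative_transform_within_open[OF _ U])
      fix y assume "y \<in> U"
      note ly = D(1)[OF this]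
      show "w$1 *\<^sub>R D y (axis 1 1) + w$2 *\<^sub>R D y (axis 2 1) = D y w"
        by (subst (3) vec2_expand[of w]) (simp only: linear_add[OF ly] linear_scale[OF ly])
    qed
    from has_derivative_unique[OF D2 this] show ?thesis by (rule fun_cong)
  qed
  \<comment> \<open>The kernel of \<open>l'\<close> is the kernel of the second fundamental
    form.\<close>
  have "inj l'"
  proof (subst linear_injective_0[OF ll'], intro allI impI)
    fix v assume "l' v = 0"
    then have "\<pi> (D2 v (axis 1 1)) = 0" "\<pi> (D2 v (axis 2 1)) = 0"
      by (simp_all add: l'_def vec_eq_iff forall_2 axis_def)
    then have "\<pi> (D2 v w) = 0" for w
      by (subst D2_expand) (simp add: linear_add[OF \<pi>(1)] linear_scale[OF \<pi>(1)])
    then show "v = 0" using nondeg by blast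
  qed
  then obtain g' where g': "linear g'" "l' \<circ> g' = id"
    using linear_injective_imp_surjective[OF ll'] linear_surjective_right_inverse[OF ll'] by blast
  \<comment> \<open>This open mapping theorem works with the derivative at \<open>x0\<close> alone,
    together with continuity on \<open>S\<close>.\<close>
  have "l x0 \<in> interior (l ` S)"
    by (rule sussmann_open_mapping[OF S l_cont x0S dl _ g'(2) subset_refl])
      (use g'(1) S x0S in \<open>auto simp: linear_linear interior_open\<close>)
  moreover have "l x0 = 0" by (simp add: l_def \<alpha>_def \<beta>_def at0)
  ultimately obtain \<delta> where \<delta>: "0 < \<delta>" "ball 0 \<delta> \<subseteq> l ` S"
    unfolding mem_interior by auto
  have lS: "l x \<bullet> \<rho> (D x u) = \<pi> (D x u)" if x: "x \<in> S" for x u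
  proof -
    have lx: "linear (D x)" and nz: "\<Delta> x \<noteq> 0" using x D(1) by (auto simp: S_def)
    have eq: "l x \<bullet> \<rho> (D x (axis j 1)) = h j x" for j
    proof -
      have "l x \<bullet> \<rho> (D x (axis j 1)) = \<alpha> x * p 1 j x + \<beta> x * p 2 j x"
        by (simp add: l_def p_def inner_vec_def sum_2 axis_def)
      also have "\<dots> = ((h 1 x * p 2 2 x - h 2 x * p 2 1 x) * p 1 j x
          + (h 2 x * p 1 1 x - h 1 x * p 1 2 x) * p 2 j x) / \<Delta> x"
        by (simp add: \<alpha>_def \<beta>_def add_divide_distrib)
      also have "\<dots> = (h j x * \<Delta> x) / \<Delta> x"
        using exhaust_2[of j] by (auto simp: \<Delta>_def algebra_simps)
      finally show ?thesis using nz by simp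
    qed
    have "D x u = u$1 *\<^sub>R D x (axis 1 1) + u$2 *\<^sub>R D x (axis 2 1)"
      by (subst vec2_expand[of u]) (simp only: linear_add[OF lx] linear_scale[OF lx])
    then show ?thesis
      using eq[of 1] eq[of 2]
      by (simp add: linear_add[OF l\<rho>] linear_scale[OF l\<rho>] linear_add[OF \<pi>(1)] linear_scale[OF \<pi>(1)]
          inner_add_right h_def)
  qed
  interpret Q: minkowski_square Q Q' Q'' by fact
  have "quadratic_form (\<lambda>s. Q (J (s, 0)))"
  proof (rule isometric_planes_imp_quadratic[OF Q.compose_linear[OF lJ iJ] \<delta>(1)])
    fix k :: "real^2" assume "norm k < \<delta>"
    then obtain x where x: "x \<in> S" "k = l x" using \<delta>(2) by auto
    then have xU: "x \<in> U" by (simp add: S_def)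
    obtain L where L: "linear L" "\<And>s. Q (D x (L s)) = Q (D x0 s)" using iso[OF xU] by blast
    \<comment> \<open>The horizontal shadow of the isometry; the height over it is restored by
      \<open>lS\<close>.\<close>
    define M where "M s = \<rho> (D x (L s))" for s
    have "linear M"
      unfolding M_def using linear_compose[OF linear_compose[OF L(1) D(1)[OF xU]] l\<rho>] by (simp add: o_def)
    from matrix_works[OF linear_matrix_vector_mul_eq[THEN iffD2, OF this]]
    have "matrix M *v s = M s" for s .
    moreover have "Q (J (M s, k \<bullet> M s)) = Q (J (s, 0))" for s
      unfolding M_def x(2) lS[OF x(1)] J_\<rho> L(2) by (simp add: J_def)
    ultimately show "\<exists>M::real^2^2. \<forall>s. Q (J (M *v s, k \<bullet> (M *v s))) = Q (J (s, 0))"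
      by (intro exI[of _ "matrix M"]) simp
  qed
  then show ?thesis by (simp add: J_def)
qed


section \<open>Passage between the surface and coordinates\<close>

lemma differential_tvec:
  assumes M: "smooth_manifold X A" and f: "smooth_map A f" and c: "c \<in> charts_at A p"
  shows "differential A f p (tvec A c p v) = frechet_derivative (f \<circ> cinv c) (at (coord c p)) v"
proof -
  have "tvec A c p v \<in> tangent_space A p"
    using tvec_linear_iso(2)[OF M c] by (auto simp: bij_betw_def)
  then show ?thesis
    using c by (simp add: differential_eq[OF M f c] tvec_def frechet_derivative_transition_same[OF M c])
qed

text \<open>In a chart the surface is the family of linear maps \<open>D x\<close>, the second
  fundamental form is \<open>\<pi>\<close> applied to the derivative of this family, and
  monochromaticity becomes a linear reparametrization \<open>L\<close> for each
  \<open>x\<close>.\<close>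

lemma quadratic_form_at_nondegenerate_point:
  fixes A :: "('m, real ^ 2) chart set" and \<Phi> :: "'v::euclidean_space \<Rightarrow> real" and f :: "'m \<Rightarrow> 'v"
  assumes fin: "finsler_manifold X A \<phi>" and mono: "monochromatic X A \<phi>"
    and bm: "banach_minkowski_norm \<Phi>" and emb: "smooth_embedding X A f"
    and isom: "isometric X A \<phi> \<Phi> f" and p: "p \<in> topspace X"
    and sff: "second_fundamental_form A f p b" and nondeg: "\<not> degenerate_on (tangent_space A p) b"
  obtains c where "c \<in> charts_at A p"
    "quadratic_form (\<lambda>v. (\<phi> p (tvec A c p v))\<^sup>2)"
proof -
  have M: "smooth_manifold X A" using fin by (simp add: finsler_manifold_def)
  have sm: "smooth_map A f" and inj: "\<And>q. q \<in> topspace X \<Longrightarrow> inj_on (differential A f q) (tangent_space A q)"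
    using emb by (auto simp: smooth_embedding_def)
  obtain c0 where "c0 \<in> charts_at A p"
    using M p unfolding smooth_manifold_def charts_at_def by blast
  then have c: "some_chart A p \<in> charts_at A p"
    unfolding some_chart_def by (rule someI)
  \<comment> \<open>The Hessian is computed in this particular chart, so it is the one to work
    in.\<close>
  define c where "c = some_chart A p"
  have c: "c \<in> charts_at A p" using c by (simp add: c_def)
  have cA: "c \<in> A" "p \<in> cdom c" using c by (auto simp: charts_at_def)
  define U where "U = coord c ` cdom c"
  define x0 where "x0 = coord c p"
  define g where "g = f \<circ> cinv c"
  define D where "D x = frechet_derivative g (at x)" for x
  have U: "open U" "x0 \<in> U"
    using M cA unfolding smooth_manifold_def U_def x0_def by auto
  have C2: "Cn_on (Suc (Suc 0)) U g"
    using sm cA unfolding smooth_map_def smooth_on_def g_def U_def by blast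
  have dg: "(g has_derivative D x) (at x)" if "x \<in> U" for x
    using C2 that unfolding D_def by (auto simp: frechet_derivative_works[symmetric])
  have dD: "(\<lambda>y. D y w) differentiable at x" if "x \<in> U" for x w
    using C2 that unfolding D_def by auto
  have lD: "linear (D x)" if "x \<in> U" for x
    using dg[OF that] by (rule has_derivative_linear)
  have T: "bij_betw (tvec A d q) UNIV (tangent_space A q)" "linear (tvec A d q)"
    if "d \<in> charts_at A q" for d q
    using tvec_linear_iso[OF M that] by blast+
  have Tin: "tvec A d q v \<in> tangent_space A q" if "d \<in> charts_at A q" for d q v
    using T(1)[OF that] by (auto simp: bij_betw_def)
  have dt: "differential A f p (tvec A c p v) = D x0 v" for v
    using differential_tvec[OF M sm c] by (simp add: D_def x0_def g_def)
  have range: "differential A f p ` tangent_space A p = range (D x0)"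
    using bij_betw_imp_surj_on[OF T(1)[OF c], symmetric] by (simp add: image_image dt)
  obtain \<pi> where \<pi>: "linear \<pi>" "surj \<pi>" "{v. \<pi> v = 0} = range (D x0)" and b: "b = hessian A (\<pi> \<circ> f) p"
    using sff unfolding second_fundamental_form_def quotient_functional_def range by blast
  define D2 where "D2 v w = frechet_derivative (\<lambda>y. D y w) (at x0) v" for v w
  have D2: "((\<lambda>y. D y w) has_derivative (\<lambda>v. D2 v w)) (at x0)" for w
    using dD[OF U(2)] unfolding D2_def by (simp add: frechet_derivative_works)
  have b_eq: "b Y Z = \<pi> (D2 (Y c) (Z c))" for Y Z
  proof -
    have bl: "bounded_linear \<pi>" using \<pi>(1) by (simp add: linear_linear)
    have fd: "frechet_derivative (\<pi> \<circ> g) (at y) w = \<pi> (D y w)" if "y \<in> U" for y w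
      using frechet_derivative_at[OF bounded_linear.has_derivative[OF bl dg[OF that]]]
      by (simp add: o_def fun_eq_iff)
    have "((\<lambda>y. \<pi> (D y (Z c))) has_derivative (\<lambda>v. \<pi> (D2 v (Z c)))) (at x0)"
      by (rule bounded_linear.has_derivative[OF bl D2])
    then have "((\<lambda>y. frechet_derivative (\<pi> \<circ> g) (at y) (Z c)) has_derivative (\<lambda>v. \<pi> (D2 v (Z c)))) (at x0)"
      by (rule has_derivative_transform_within_open[OF _ U]) (simp add: fd)
    from frechet_derivative_at[OF this] show ?thesis
      unfolding b hessian_def c_def[symmetric] Let_def second_differential_def x0_def[symmetric]
        comp_assoc g_def[symmetric] by (simp add: fun_eq_iff)
  qed
  obtain Q' Q'' where Q: "minkowski_square (\<lambda>v. (\<Phi> v)\<^sup>2) Q' Q''"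
    using banach_minkowski_norm_square[OF bm] by blast
  have "quadratic_form (\<lambda>s. (\<Phi> (D x0 s))\<^sup>2)"
  proof (rule quadratic_form_on_nondegenerate_plane[OF Q U lD dD _ D2 \<pi>])
    show "inj (D x0)"
      unfolding dt[symmetric]
      using comp_inj_on[of "tvec A c p" UNIV "differential A f p"] inj[OF p] T(1)[OF c]
      by (simp add: comp_def bij_betw_def)
    show "\<exists>w. \<pi> (D2 v w) \<noteq> 0" if v: "v \<noteq> 0" for v
    proof -
      have vc: "tvec A c p v c = v"
        using c by (simp add: tvec_def frechet_derivative_transition_same[OF M c])
      then have "tvec A c p v \<noteq> 0" using v by (metis zero_fun_apply)
      then obtain Z where "b (tvec A c p v) Z \<noteq> 0"
        using nondeg Tin[OF c] unfolding degenerate_on_def by blast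
      then show ?thesis by (auto simp: b_eq vc)
    qed
    show "\<exists>L. linear L \<and> (\<forall>s. (\<Phi> (D x (L s)))\<^sup>2 = (\<Phi> (D x0 s))\<^sup>2)" if x: "x \<in> U" for x
    proof -
      define q where "q = cinv c x"
      have q: "q \<in> cdom c" "coord c q = x"
        using x unfolding U_def q_def by (auto intro: inv_into_into f_inv_into_f)
      have qc: "c \<in> charts_at A q" using q cA by (simp add: charts_at_def)
      have qX: "q \<in> topspace X" using q cA M unfolding smooth_manifold_def by blast
      obtain L where L: "linear L" "bij_betw L (tangent_space A p) (tangent_space A q)"
        "\<And>Y. Y \<in> tangent_space A p \<Longrightarrow> \<phi> q (L Y) = \<phi> p Y"
        using mono p qX unfolding monochromatic_def by blast
      have "linear (\<lambda>s. L (tvec A c p s) c)"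
        by (rule linearI)
          (simp_all add: linear_add[OF T(2)[OF c]] linear_scale[OF T(2)[OF c]] linear_add[OF L(1)] linear_scale[OF L(1)])
      moreover have "\<Phi> (D x (L (tvec A c p s) c)) = \<Phi> (D x0 s)" for s
      proof -
        have LT: "L (tvec A c p s) \<in> tangent_space A q"
          using L(2) Tin[OF c] by (auto simp: bij_betw_def)
        have "\<Phi> (D x (L (tvec A c p s) c)) = \<Phi> (differential A f q (L (tvec A c p s)))"
          by (simp add: differential_eq[OF M sm qc LT] D_def g_def q(2))
        also have "\<dots> = \<phi> q (L (tvec A c p s))"
          using isom qX LT by (simp add: isometric_def)
        also have "\<dots> = \<phi> p (tvec A c p s)" by (rule L(3)[OF Tin[OF c]])
        also have "\<dots> = \<Phi> (differential A f p (tvec A c p s))"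
          using isom p Tin[OF c] by (simp add: isometric_def)
        finally show ?thesis by (simp add: dt)
      qed
      ultimately show ?thesis by (intro exI[of _ "\<lambda>s. L (tvec A c p s) c"]) simp
    qed
  qed
  moreover have "\<Phi> (D x0 s) = \<phi> p (tvec A c p s)" for s
    using isom p Tin[OF c, of s] dt[of s] unfolding isometric_def by metis
  ultimately show ?thesis using that[OF c] by simp
qed

text \<open>The form is pulled back along an isometry from the tangent space at \<open>q\<close> to
  the one at \<open>p\<close>; its definiteness comes from positivity of the norm at
  \<open>q\<close>.\<close>

lemma riemannian_if_quadratic_at_point:
  fixes A :: "('m, 'e::euclidean_space) chart set"
  assumes fin: "finsler_manifold X A \<phi>" and mono: "monochromatic X A \<phi>"
    and p: "p \<in> topspace X" and c: "c \<in> charts_at A p"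
    and quad: "quadratic_form (\<lambda>v. (\<phi> p (tvec A c p v))\<^sup>2)"
  shows "riemannian X A \<phi>"
  unfolding riemannian_def
proof
  fix q assume q: "q \<in> topspace X"
  have M: "smooth_manifold X A" using fin by (simp add: finsler_manifold_def)
  obtain B where B: "bilinear B" "\<And>s t. B s t = B t s" "\<And>s. (\<phi> p (tvec A c p s))\<^sup>2 = B s s"
    using quad unfolding quadratic_form_def by blast
  obtain L where L: "linear L" "bij_betw L (tangent_space A q) (tangent_space A p)"
    "\<And>Y. Y \<in> tangent_space A q \<Longrightarrow> \<phi> p (L Y) = \<phi> q Y"
    using mono p q unfolding monochromatic_def by blast
  obtain d where d: "d \<in> charts_at A q"
    using M q unfolding smooth_manifold_def charts_at_def by blast
  have pos: "0 \<le> \<phi> q Y" "Y \<noteq> 0 \<Longrightarrow> 0 < \<phi> q Y" if Y: "Y \<in> tangent_space A q" for Y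
  proof -
    have "minkowski_norm_on UNIV (\<lambda>v. \<phi> q (tvec A d q v))"
      using fin q d unfolding finsler_manifold_def banach_minkowski_norm_def by blast
    moreover obtain v where v: "Y = tvec A d q v"
      using Y tvec_linear_iso(2)[OF M d] by (auto simp: bij_betw_def)
    moreover have "v \<noteq> 0" if "Y \<noteq> 0"
      using that v linear_0[OF tvec_linear_iso(1)[OF M d]] by auto
    ultimately show "0 \<le> \<phi> q Y" "Y \<noteq> 0 \<Longrightarrow> 0 < \<phi> q Y"
      unfolding minkowski_norm_on_def by blast+
  qed
  have norm: "(\<phi> q Y)\<^sup>2 = B (L Y c) (L Y c)" if Y: "Y \<in> tangent_space A q" for Y
  proof -
    have "L Y \<in> tangent_space A p" using L(2) Y by (auto simp: bij_betw_def)
    then obtain v where v: "L Y = tvec A c p v"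
      using tvec_linear_iso(2)[OF M c] by (auto simp: bij_betw_def)
    then have "L Y c = v"
      using c by (simp add: tvec_def frechet_derivative_transition_same[OF M c])
    then show ?thesis using B(3)[of v] v L(3)[OF Y] by simp
  qed
  have lin: "linear (\<lambda>Y. L Y c)"
    by (rule linearI) (simp_all add: linear_add[OF L(1)] linear_scale[OF L(1)])
  show "euclidean_norm_on (tangent_space A q) (\<phi> q)"
    unfolding euclidean_norm_on_def
  proof (intro exI[of _ "\<lambda>Y Z. B (L Y c) (L Z c)"] conjI ballI impI)
    show "bilinear (\<lambda>Y Z. B (L Y c) (L Z c))"
      using B(1) linear_compose[OF lin, unfolded o_def] unfolding bilinear_def by blast
    show "B (L Y c) (L Z c) = B (L Z c) (L Y c)" for Y Z by (rule B(2))
    show "0 < B (L Y c) (L Y c)" if "Y \<in> tangent_space A q" "Y \<noteq> 0" for Y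
      using pos(2)[OF that] by (simp add: norm[OF that(1), symmetric])
    show "\<phi> q Y = sqrt (B (L Y c) (L Y c))" if "Y \<in> tangent_space A q" for Y
      using pos(1)[OF that] by (simp add: norm[OF that, symmetric])
  qed
qed

theorem theorem2:
  fixes X :: "'m topology"
    and A :: "('m, real ^ 2) chart set"
    and \<phi> :: "'m \<Rightarrow> ('m, real ^ 2) tvector \<Rightarrow> real"
    and \<Phi> :: "'v::euclidean_space \<Rightarrow> real"
    and f :: "'m \<Rightarrow> 'v"
  assumes "finsler_manifold X A \<phi>"
    and "monochromatic X A \<phi>"
    and "\<not> riemannian X A \<phi>"
    and "DIM('v) = 3"
    and "banach_minkowski_norm \<Phi>"
    and "smooth_embedding X A f"
    and "isometric X A \<phi> \<Phi> f"
  shows "\<forall>p\<in>topspace X. \<forall>b. second_fundamental_form A f p b \<longrightarrow> degenerate_on (tangent_space A p) b"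
proof (intro ballI allI impI)
  fix p b assume p: "p \<in> topspace X" and b: "second_fundamental_form A f p b"
  show "degenerate_on (tangent_space A p) b"
  proof (rule ccontr)
    assume "\<not> degenerate_on (tangent_space A p) b"
    from quadratic_form_at_nondegenerate_point[OF assms(1,2,5,6,7) p b this]
    obtain c where "c \<in> charts_at A p" "quadratic_form (\<lambda>v. (\<phi> p (tvec A c p v))\<^sup>2)"
      by blast
    from riemannian_if_quadratic_at_point[OF assms(1,2) p this] assms(3)
    show False by blast
  qed
qed

end
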